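(* Let $\mathbb{K}$ denote a subfield of the complex field $\mathbb{C}$ and consider generic arrangements $\mathcal{A}$ of $6$ planes in $\mathbb{K}^3$. The minimal fields over which an arrangement of type $\nu$ exists are as follows (that is, for the indicated field $F_\nu$, a type $\nu$ arrangement in $\mathbb{K}^3$ exists if and only if $F_\nu\subseteq\mathbb{K}$): (a) $F_\nu=\mathbb{Q}$ for $\nu=1^6,\ 1^42^1,\ 1^33^1,\ 1^22^2,\ 1^24^1,\ 1^12^13^1$; (b) $F_\nu=\mathbb{Q}(\sqrt5)$ for $\nu=1^15^1$; (c) $F_\nu=\mathbb{Q}(\sqrt{-3})$ for $\nu=3^2$; (d) for $\nu=2^3,\ 2^14^1,\ 6^1$, no arrangement of type $\nu$ exists over any commutative field of characteristic $0$.
   Context: A generic arrangement of $6$ planes in $\mathbb{K}^3$ is a central arrangement $H_i=\ker\alpha_i$, $i=1,\dots,6$, such that any three of the $\alpha_i$ are linearly independent. Its translates $\{H_1^{x_1},\dots,H_6^{x_6}\}$, with $H_i^{x_i}$ parallel to $H_i$ (up to rescaling of $x_i$, $H_i^{x_i}=\{v:\alpha_i(v)=x_i\}$), are parametrized by $x\in\mathbb{K}^6$. For $L\subset\{1,\dots,6\}$ with $|L|=4$, $D_L\subset\mathbb{K}^6$ is the hyperplane of translates whose four planes indexed by $L$ have a common point; the discriminantal arrangement $\mathcal{B}(6,3,\mathcal{A})$ is the arrangement of all $D_L$. Correspondence with permutations: the permutation $(p_1p_2)(p_3p_4)(p_5p_6)\in S_6$, with $\{p_1,\dots,p_6\}=\{1,\dots,6\}$,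 corresponds to the $3$-set $\mathbb{T}=\{\{p_1,p_2,p_3,p_4\},\{p_3,p_4,p_5,p_6\},\{p_1,p_2,p_5,p_6\}\}$. The $3$-set $\mathbb{T}$ gives a non-very generic intersection of $\mathcal{B}(6,3,\mathcal{A})$ if $\bigcap_{L\in\mathbb{T}}D_L$ has codimension strictly less than $3$. Graph: $\phi$ is the outer automorphism of $S_6$ defined by $\phi((12))=(15)(26)(34)$, $\phi((23))=(12)(35)(46)$, $\phi((34))=(15)(24)(36)$, $\phi((45))=(14)(26)(35)$, $\phi((56))=(15)(23)(46)$. $\phi(K_6)$ is the complete graph on vertices $\phi(1),\dots,\phi(6)$ in which the edge joining $\phi(i)$ and $\phi(j)$ is identified with the permutation $\phi((ij))$ (a product of three disjoint transpositions). A partition of the vertex set has type $\nu=i_1^{n_1}\cdots i_l^{n_l}$ if it has exactly $n_j$ blocks of size $i_j$ for each $j$; such a partition is written $\mathcal{V}_\nu$, and $\phi(K_6)[\mathcal{V}_\nu]$ is the subgraph whose connected components are the complete graphs on the blocks. For every generic $\mathcal{A}$ there is a unique partition $\mathcal{V}_\nu$ such that the edges of $\phi(K_6)[\mathcal{V}_\nu]$ are exactly the permutations whose $3$-sets give non-very generic intersections of $\mathcal{B}(6,3,\mathcal{A})$; the type of this partition is called the type of $\mathcal{A}$. *)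

theory Defs
  imports
    "HOL-Analysis.Analysis"
    "HOL-Combinatorics.Transposition"
    "HOL-Library.Multiset"
    "HOL-Library.Disjoint_Sets"
    "HOL-Algebra.Bij"
    "HOL-Algebra.Generated_Fields"
    "HOL-Algebra.Algebraic_Closure_Type"
begin

text \<open>
  The index set \<open>{1,\<dots>,6}\<close> is the type \<^typ>\<open>6\<close>, whose elements are \<open>1, 2, 3, 4, 5, 6\<close>
  (with \<open>6 = 0\<close> in this type).  The arrangement with planes \<open>H\<^sub>i = ker \<alpha>\<^sub>i\<close> is given by the
  matrix \<open>A\<close> whose \<open>i\<close>-th row is the coefficient vector of the linear form \<open>\<alpha>\<^sub>i\<close>,
  so that \<open>\<alpha>\<^sub>i(v) = (A *v v) $ i\<close>.
\<close>

definition generic_arrangement :: "'a::field^3^6 \<Rightarrow> bool" where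
  "generic_arrangement A \<longleftrightarrow>
     (\<forall>S. card S = 3 \<longrightarrow> inj_on (\<lambda>i. row i A) S \<and> vec.independent ((\<lambda>i. row i A) ` S))"

definition translate :: "'a::field^3^6 \<Rightarrow> 6 \<Rightarrow> 'a \<Rightarrow> ('a^3) set" where
  "translate A i c = {v. (A *v v) $ i = c}"

definition discr_hyperplane :: "'a::field^3^6 \<Rightarrow> 6 set \<Rightarrow> ('a^6) set" where
  "discr_hyperplane A L = {x. (\<Inter>i\<in>L. translate A i (x $ i)) \<noteq> {}}"

definition codim :: "('a::field^6) set \<Rightarrow> nat" where
  "codim V = CARD(6) - vec.dim V"

definition non_very_generic :: "'a::field^3^6 \<Rightarrow> 6 set set \<Rightarrow> bool" where
  "non_very_generic A T \<longleftrightarrow> codim (\<Inter>L\<in>T. discr_hyperplane A L) < 3"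

abbreviation transp :: "6 \<Rightarrow> 6 \<Rightarrow> 6 \<Rightarrow> 6" where
  "transp \<equiv> Transposition.transpose"

definition corresponds :: "(6 \<Rightarrow> 6) \<Rightarrow> 6 set set \<Rightarrow> bool" where
  "corresponds \<sigma> T \<longleftrightarrow>
     (\<exists>p1 p2 p3 p4 p5 p6. {p1, p2, p3, p4, p5, p6} = UNIV \<and>
        \<sigma> = transp p1 p2 \<circ> transp p3 p4 \<circ> transp p5 p6 \<and>
        T = {{p1, p2, p3, p4}, {p3, p4, p5, p6}, {p1, p2, p5, p6}})"

definition non_very_generic_perms :: "'a::field^3^6 \<Rightarrow> (6 \<Rightarrow> 6) set" where
  "non_very_generic_perms A = {\<sigma>. \<exists>T. corresponds \<sigma> T \<and> non_very_generic A T}"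

text \<open>
  The transpositions \<open>(12), \<dots>, (56)\<close> generate the symmetric group, and elements of
  \<^const>\<open>auto\<close> are extensional, so at most one function satisfies the following predicate.
  One does: the five images satisfy the Coxeter relations of the symmetric group.
\<close>

definition is_phi :: "((6 \<Rightarrow> 6) \<Rightarrow> (6 \<Rightarrow> 6)) \<Rightarrow> bool" where
  "is_phi \<phi> \<longleftrightarrow> \<phi> \<in> auto (BijGroup (UNIV :: 6 set)) \<and>
     \<phi> (transp 1 2) = transp 1 5 \<circ> transp 2 6 \<circ> transp 3 4 \<and>
     \<phi> (transp 2 3) = transp 1 2 \<circ> transp 3 5 \<circ> transp 4 6 \<and>
     \<phi> (transp 3 4) = transp 1 5 \<circ> transp 2 4 \<circ> transp 3 6 \<and>
     \<phi> (transp 4 5) = transp 1 4 \<circ> transp 2 6 \<circ> transp 3 5 \<and>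
     \<phi> (transp 5 6) = transp 1 5 \<circ> transp 2 3 \<circ> transp 4 6"

text \<open>
  The vertex \<open>\<phi>(i)\<close> of \<open>\<phi>(K\<^sub>6)\<close> is represented by its label \<open>i\<close>, and an edge by the
  permutation \<open>\<phi>((i j))\<close> with which it is identified.
\<close>

definition subgraph_edges :: "((6 \<Rightarrow> 6) \<Rightarrow> (6 \<Rightarrow> 6)) \<Rightarrow> 6 set set \<Rightarrow> (6 \<Rightarrow> 6) set" where
  "subgraph_edges \<phi> P = {\<phi> (transp i j) | i j. i \<noteq> j \<and> (\<exists>B\<in>P. i \<in> B \<and> j \<in> B)}"

text \<open>
  A type \<open>i\<^sub>1\<^bsup>n\<^sub>1\<^esup> \<cdots> i\<^sub>l\<^bsup>n\<^sub>l\<^esup>\<close> is the multiset of block sizes.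
\<close>

definition partition_type :: "6 set set \<Rightarrow> nat multiset" where
  "partition_type P = image_mset card (mset_set P)"

definition has_type ::
    "((6 \<Rightarrow> 6) \<Rightarrow> (6 \<Rightarrow> 6)) \<Rightarrow> 'a::field^3^6 \<Rightarrow> nat multiset \<Rightarrow> bool" where
  "has_type \<phi> A \<nu> \<longleftrightarrow>
     (\<exists>P. partition_on UNIV P \<and> partition_type P = \<nu> \<and>
        subgraph_edges \<phi> P = non_very_generic_perms A)"

definition complex_adjoin :: "complex \<Rightarrow> complex set" where
  "complex_adjoin z = generate_field ring_of_type_algebra {z}"

end

theory Submission
  imports Defs
begin

text \<open>
  A permutation \<open>(p q)(r s)(t u)\<close> gives a non-very generic intersection iff the three lines
  \<open>H\<^sub>p \<inter> H\<^sub>q\<close>, \<open>H\<^sub>r \<inter> H\<^sub>s\<close>, \<open>H\<^sub>t \<inter> H\<^sub>u\<close> are coplanar, which is the vanishing of a difference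
  of two products of \<open>3 \<times> 3\<close> minors \<open>[ijk]\<close> of the coefficient matrix.  Up to sign and a factor
  \<open>3\<close> the difference belonging to the edge \<open>\<phi>((i j))\<close> is \<open>c\<^sub>i - c\<^sub>j\<close> for six numbers
  \<open>c\<^sub>1, \<dots>, c\<^sub>6\<close> with sum \<open>0\<close> (the Joubert invariants of six points of the projective plane),
  so the type of an arrangement records which of the \<open>c\<^sub>i\<close> coincide.  The sums of three of the
  \<open>c\<^sub>i\<close> are up to sign the products \<open>3[ijk][lmn]\<close>, so genericity means that no three of them
  sum to \<open>0\<close>; this excludes the types \<open>2\<^sup>3\<close>, \<open>2\<^sup>1 4\<^sup>1\<close>, \<open>6\<^sup>1\<close>.  Finally
  \<open>4 \<Sum> c\<^sub>i\<^sup>4 - (\<Sum> c\<^sub>i\<^sup>2)\<^sup>2\<close> is a square in the field, being the square of a multiple of the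
  invariant that vanishes when the six points lie on a conic.  For type \<open>1\<^sup>1 5\<^sup>1\<close> it equals \<open>5\<close>
  times a nonzero square and for type \<open>3\<^sup>2\<close> it equals \<open>-3\<close> times a nonzero square.
\<close>

no_notation fps_nth (infixl "$" 75)

section \<open>Minors and Joubert invariants\<close>

text \<open>Written out in the entries rather than through \<open>det\<close>, so that identities
  between minors become polynomial identities that \<open>algebra_simps\<close> decides by
  normalising.\<close>

definition bracket :: "'a::field^3^6 \<Rightarrow> 6 \<Rightarrow> 6 \<Rightarrow> 6 \<Rightarrow> 'a" where
  "bracket A i j k =
     A$i$1 * (A$j$2 * A$k$3 - A$j$3 * A$k$2)
   - A$i$2 * (A$j$1 * A$k$3 - A$j$3 * A$k$1)
   + A$i$3 * (A$j$1 * A$k$2 - A$j$2 * A$k$1)"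

text \<open>
  Up to sign, the determinant of direction vectors of the lines \<open>H\<^sub>p \<inter> H\<^sub>q\<close>, \<open>H\<^sub>r \<inter> H\<^sub>s\<close>, \<open>H\<^sub>t \<inter> H\<^sub>u\<close>.
\<close>

definition concurrence :: "'a::field^3^6 \<Rightarrow> 6 \<Rightarrow> 6 \<Rightarrow> 6 \<Rightarrow> 6 \<Rightarrow> 6 \<Rightarrow> 6 \<Rightarrow> 'a" where
  "concurrence A p q r s t u =
     bracket A p r s * bracket A q t u - bracket A q r s * bracket A p t u"

text \<open>
  The arguments of \<^const>\<open>concurrence\<close> are the pairs of the permutations \<open>\<phi>((1 i))\<close>; the signs make the
  remaining ten concurrences differences of these five.
\<close>

definition joubert_diff :: "'a::field^3^6 \<Rightarrow> 6 \<Rightarrow> 'a" where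
  "joubert_diff A i =
    (if i = 2 then concurrence A 1 5 2 6 3 4
     else if i = 3 then - concurrence A 1 4 2 3 5 6
     else if i = 4 then concurrence A 1 3 2 5 4 6
     else if i = 5 then concurrence A 1 2 3 6 4 5
     else if i = 6 then - concurrence A 1 6 2 4 3 5
     else 0)"

text \<open>The summand independent of \<open>i\<close> is fixed by c_1 + c_2 + c_3 = 3[136][245];
  the six values then sum to 0. The factor 3 before \<open>joubert_diff A i\<close> keeps the
  definition free of division.\<close>

definition joubert :: "'a::field^3^6 \<Rightarrow> 6 \<Rightarrow> 'a" where
  "joubert A i = bracket A 1 3 6 * bracket A 2 4 5 + joubert_diff A 2 + joubert_diff A 3
     - 3 * joubert_diff A i"

text \<open>In \<open>concurrence A 1 q r s t u\<close> with r < s and t < u only the index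
  \<open>q\<close> can stand out of order. These rules move it to its place.\<close>

lemma bracket_sort:
  shows "bracket A 3 2 4 = - bracket A 2 3 4"
  and "bracket A 3 2 5 = - bracket A 2 3 5"
  and "bracket A 3 2 6 = - bracket A 2 3 6"
  and "bracket A 4 2 3 = bracket A 2 3 4"
  and "bracket A 4 2 5 = - bracket A 2 4 5"
  and "bracket A 4 2 6 = - bracket A 2 4 6"
  and "bracket A 4 3 5 = - bracket A 3 4 5"
  and "bracket A 4 3 6 = - bracket A 3 4 6"
  and "bracket A 5 2 3 = bracket A 2 3 5"
  and "bracket A 5 2 4 = bracket A 2 4 5"
  and "bracket A 5 2 6 = - bracket A 2 5 6"
  and "bracket A 5 3 4 = bracket A 3 4 5"
  and "bracket A 5 3 6 = - bracket A 3 5 6"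
  and "bracket A 5 4 6 = - bracket A 4 5 6"
  and "bracket A 6 2 3 = bracket A 2 3 6"
  and "bracket A 6 2 4 = bracket A 2 4 6"
  and "bracket A 6 2 5 = bracket A 2 5 6"
  and "bracket A 6 3 4 = bracket A 3 4 6"
  and "bracket A 6 3 5 = bracket A 3 5 6"
  and "bracket A 6 4 5 = bracket A 4 5 6"
  by (simp_all add: bracket_def algebra_simps)

text \<open>
  The ten products \<open>[ijk][lmn]\<close> span a space of dimension five; the right-hand sides use the standard tableaux
      as a basis.
\<close>

lemma plucker:
  shows "bracket A 1 2 6 * bracket A 3 4 5 = bracket A 1 2 3 * bracket A 4 5 6
      - bracket A 1 2 4 * bracket A 3 5 6 + bracket A 1 2 5 * bracket A 3 4 6"
  and "bracket A 1 3 6 * bracket A 2 4 5 = - bracket A 1 2 3 * bracket A 4 5 6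
      - bracket A 1 3 4 * bracket A 2 5 6 + bracket A 1 3 5 * bracket A 2 4 6"
  and "bracket A 1 4 5 * bracket A 2 3 6 = - bracket A 1 2 3 * bracket A 4 5 6
      + bracket A 1 2 4 * bracket A 3 5 6 - bracket A 1 2 5 * bracket A 3 4 6
      - bracket A 1 3 4 * bracket A 2 5 6 + bracket A 1 3 5 * bracket A 2 4 6"
  and "bracket A 1 4 6 * bracket A 2 3 5 = - bracket A 1 2 3 * bracket A 4 5 6
      - bracket A 1 2 5 * bracket A 3 4 6 + bracket A 1 3 5 * bracket A 2 4 6"
  and "bracket A 1 5 6 * bracket A 2 3 4 = bracket A 1 2 3 * bracket A 4 5 6 - bracket A 1 2 4 * bracket A 3 5 6
      + bracket A 1 3 4 * bracket A 2 5 6"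
  by (simp_all add: bracket_def algebra_simps)

lemmas plucker_commuted = plucker[THEN trans[OF mult.commute]]

text \<open>The pairs on the left are those of \<phi>((i j)) for the two indices on the right. Both
  sides are combinations of products [ijk][lmn], and straightening with \<open>plucker\<close>
  yields the same combination of standard tableaux.\<close>

lemma concurrence_joubert:
  shows "3 * concurrence A 1 5 2 6 3 4 = joubert A 1 - joubert A 2"
  and "3 * concurrence A 1 4 2 3 5 6 = joubert A 3 - joubert A 1"
  and "3 * concurrence A 1 3 2 5 4 6 = joubert A 1 - joubert A 4"
  and "3 * concurrence A 1 2 3 6 4 5 = joubert A 1 - joubert A 5"
  and "3 * concurrence A 1 6 2 4 3 5 = joubert A 6 - joubert A 1"
  and "3 * concurrence A 1 2 3 5 4 6 = joubert A 3 - joubert A 2"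
  and "3 * concurrence A 1 6 2 3 4 5 = joubert A 4 - joubert A 2"
  and "3 * concurrence A 1 3 2 4 5 6 = joubert A 5 - joubert A 2"
  and "3 * concurrence A 1 4 2 5 3 6 = joubert A 2 - joubert A 6"
  and "3 * concurrence A 1 5 2 4 3 6 = joubert A 4 - joubert A 3"
  and "3 * concurrence A 1 6 2 5 3 4 = joubert A 3 - joubert A 5"
  and "3 * concurrence A 1 3 2 6 4 5 = joubert A 3 - joubert A 6"
  and "3 * concurrence A 1 4 2 6 3 5 = joubert A 5 - joubert A 4"
  and "3 * concurrence A 1 2 3 4 5 6 = joubert A 6 - joubert A 4"
  and "3 * concurrence A 1 5 2 3 4 6 = joubert A 6 - joubert A 5"
  by (simp_all add: joubert_def joubert_diff_def concurrence_def bracket_sort plucker plucker_commuted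
      algebra_simps)

lemma bracket_joubert:
  shows "3 * (bracket A 1 2 3 * bracket A 4 5 6) = joubert A 3 + joubert A 4 + joubert A 5"
  and "3 * (bracket A 1 2 4 * bracket A 3 5 6) = joubert A 3 + joubert A 5 + joubert A 6"
  and "3 * (bracket A 1 2 5 * bracket A 3 4 6) = joubert A 1 + joubert A 3 + joubert A 6"
  and "3 * (bracket A 1 2 6 * bracket A 3 4 5) = joubert A 1 + joubert A 3 + joubert A 4"
  and "3 * (bracket A 1 3 4 * bracket A 2 5 6) = joubert A 1 + joubert A 5 + joubert A 6"
  and "3 * (bracket A 1 3 5 * bracket A 2 4 6) = joubert A 1 + joubert A 3 + joubert A 5"
  and "3 * (bracket A 1 3 6 * bracket A 2 4 5) = joubert A 1 + joubert A 2 + joubert A 3"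
  and "3 * (bracket A 1 4 5 * bracket A 2 3 6) = joubert A 2 + joubert A 3 + joubert A 5"
  and "3 * (bracket A 1 4 6 * bracket A 2 3 5) = joubert A 1 + joubert A 2 + joubert A 5"
  and "3 * (bracket A 1 5 6 * bracket A 2 3 4) = joubert A 1 + joubert A 4 + joubert A 5"
  by (simp_all add: joubert_def joubert_diff_def concurrence_def bracket_sort plucker plucker_commuted
      algebra_simps)

lemma sum_joubert: "joubert A 1 + joubert A 2 + joubert A 3 + joubert A 4 + joubert A 5 + joubert A 6 = 0"
  by (simp add: joubert_def joubert_diff_def concurrence_def bracket_sort plucker plucker_commuted
      algebra_simps)

section \<open>Power sums and the quartic invariant\<close>

text \<open>Newton's identities for the elementary symmetric functions of \<open>a\<close>,
  \<open>b\<close>, \<open>c\<close>, after expansion in \<open>t\<close>. The product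
  \<open>a*b*c\<close> stands as a factor of its own, so that it can be replaced by another product
  of the same value.\<close>

lemma sum_fourth_powers:
  fixes a b c t :: "'a::comm_ring_1"
  shows "(t + 3*a)^4 + (t + 3*b)^4 + (t + 3*c)^4 =
   3*t^4 + 12*t^3*(a+b+c) + 54*t^2*((a+b+c)^2 - 2*(a*b+b*c+c*a))
   + 108*t*((a+b+c)^3 - 3*(a+b+c)*(a*b+b*c+c*a) + 3*(a*b*c))
   + 81*((a+b+c)^4 - 4*(a+b+c)^2*(a*b+b*c+c*a) + 2*(a*b+b*c+c*a)^2 + 4*(a+b+c)*(a*b*c))"
  by (simp add: power4_eq_xxxx power3_eq_cube power2_eq_square algebra_simps)

lemma sum_squares:
  fixes a b c t :: "'a::comm_ring_1"
  shows "(t + 3*a)^2 + (t + 3*b)^2 + (t + 3*c)^2 =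
   3*t^2 + 6*t*(a+b+c) + 9*((a+b+c)^2 - 2*(a*b+b*c+c*a))"
  by (simp add: power2_eq_square algebra_simps)

text \<open>By Newton's identities the left-hand side is a polynomial in \<open>E\<close>,
  \<open>F\<close>, the two second elementary symmetric functions and the common product. In these
  quantities everything cancels except a square.\<close>

lemma quartic_identity:
  fixes a b c x y z :: "'a::comm_ring_1"
  assumes "a * b * c = x * y * z"
  defines "E \<equiv> a + b + c" and "F \<equiv> x + y + z"
  shows "4 * ((F - 2*E + 3*a)^4 + (F - 2*E + 3*b)^4 + (F - 2*E + 3*c)^4 +
             ((E - 2*F + 3*x)^4 + (E - 2*F + 3*y)^4 + (E - 2*F + 3*z)^4))
       - ((F - 2*E + 3*a)^2 + (F - 2*E + 3*b)^2 + (F - 2*E + 3*c)^2 +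
             ((E - 2*F + 3*x)^2 + (E - 2*F + 3*y)^2 + (E - 2*F + 3*z)^2))^2
    = (18 * ((a*b+b*c+c*a) - (x*y + y*z + z*x)))^2"
  unfolding sum_fourth_powers sum_squares assms(1) E_def[symmetric] F_def[symmetric]
  by (simp add: power4_eq_xxxx power3_eq_cube power2_eq_square algebra_simps)

lemma UNIV_6: "(UNIV :: 6 set) = {1, 2, 3, 4, 5, 6}"
proof -
  have "card {1, 2, 3, 4, 5, 6 :: 6} = card (UNIV :: 6 set)"
    by simp
  then show ?thesis
    by (metis card_subset_eq finite subset_UNIV)
qed

lemma forall_6: "(\<forall>i :: 6. P i) \<longleftrightarrow> P 1 \<and> P 2 \<and> P 3 \<and> P 4 \<and> P 5 \<and> P 6"
  using UNIV_6 by (metis (no_types, lifting) UNIV_I empty_iff insert_iff)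

lemma exhaust_6: "(i :: 6) = 1 \<or> i = 2 \<or> i = 3 \<or> i = 4 \<or> i = 5 \<or> i = 6"
  using UNIV_I[of i] unfolding UNIV_6 by simp

lemma sum_6: "sum f (UNIV :: 6 set) = f 1 + f 2 + f 3 + f 4 + f 5 + f 6"
  unfolding UNIV_6 by (simp add: ac_simps)

lemma sum_UNIV_joubert: "(\<Sum>i\<in>UNIV. joubert A i) = 0"
  by (simp add: sum_6 sum_joubert)

text \<open>
  Cofactor expansion of the minors of rows \<open>4, 5, 6\<close> written in terms of the frame formed by rows \<open>1, 2, 3\<close>.
\<close>

lemma plucker_frame:
  shows "bracket A 1 2 3 * bracket A 3 5 6 = bracket A 1 3 5 * bracket A 2 3 6
      - bracket A 2 3 5 * bracket A 1 3 6"
    and "bracket A 1 2 3 * bracket A 3 4 6 = bracket A 1 3 4 * bracket A 2 3 6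
        - bracket A 2 3 4 * bracket A 1 3 6"
    and "bracket A 1 2 3 * bracket A 2 5 6 = bracket A 1 2 5 * bracket A 2 3 6
        - bracket A 2 3 5 * bracket A 1 2 6"
    and "bracket A 1 2 3 * bracket A 2 4 6 = bracket A 1 2 4 * bracket A 2 3 6
        - bracket A 2 3 4 * bracket A 1 2 6"
    and "bracket A 1 2 3 * bracket A 1 5 6 = bracket A 1 2 5 * bracket A 1 3 6
        - bracket A 1 3 5 * bracket A 1 2 6"
    and "bracket A 1 2 3 * bracket A 4 5 6 = bracket A 2 3 4 * bracket A 1 5 6
        - bracket A 1 3 4 * bracket A 2 5 6 + bracket A 1 2 4 * bracket A 3 5 6"
  by (simp_all add: bracket_def algebra_simps)

text \<open>
  Here \<open>a, b, c\<close> and \<open>x, y, z\<close> are, up to a common factor, the even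
      and the odd terms of the \<open>3 \<times> 3\<close> determinant of the
  coordinates of rows \<open>4, 5, 6\<close> in the frame of rows \<open>1, 2, 3\<close>.  Both triples have the same product.
\<close>

lemma joubert_frame:
  fixes A :: "'a::field^3^6"
  defines "D \<equiv> bracket A 1 2 3"
  defines "a \<equiv> - bracket A 2 3 4 * bracket A 1 3 5 * bracket A 1 2 6"
    and "b \<equiv> - bracket A 1 3 4 * bracket A 1 2 5 * bracket A 2 3 6"
    and "c \<equiv> - bracket A 1 2 4 * bracket A 2 3 5 * bracket A 1 3 6"
    and "x \<equiv> - bracket A 2 3 4 * bracket A 1 2 5 * bracket A 1 3 6"
    and "y \<equiv> - bracket A 1 2 4 * bracket A 1 3 5 * bracket A 2 3 6"
    and "z \<equiv> - bracket A 1 3 4 * bracket A 2 3 5 * bracket A 1 2 6"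
  defines "E \<equiv> a + b + c" and "F \<equiv> x + y + z"
  shows "D * joubert A 1 = F - 2*E + 3*a" "D * joubert A 2 = F - 2*E + 3*b" "D * joubert A 6 = F - 2*E + 3*c"
    "D * joubert A 3 = E - 2*F + 3*x" "D * joubert A 4 = E - 2*F + 3*y" "D * joubert A 5 = E - 2*F + 3*z"
proof -
  let ?X1 = "bracket A 1 2 3 * bracket A 4 5 6"
  let ?X2 = "bracket A 1 2 4 * bracket A 3 5 6"
  let ?X3 = "bracket A 1 2 5 * bracket A 3 4 6"
  let ?X4 = "bracket A 1 3 4 * bracket A 2 5 6"
  let ?X5 = "bracket A 1 3 5 * bracket A 2 4 6"
  \<comment> \<open>\<open>D\<close> is moved next to the minor containing only one of the rows 1,
    2, 3, which \<open>plucker_frame\<close> then turns into minors containing two of them.\<close>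
  have X: "D * ?X2 = bracket A 1 2 4 * (D * bracket A 3 5 6)"
     "D * ?X3 = bracket A 1 2 5 * (D * bracket A 3 4 6)"
     "D * ?X4 = bracket A 1 3 4 * (D * bracket A 2 5 6)"
     "D * ?X5 = bracket A 1 3 5 * (D * bracket A 2 4 6)"
    by (simp_all add: algebra_simps)
  \<comment> \<open>The minor [456] contains none of the rows 1, 2, 3 and needs two expansions: the
    first uses the factor [123] of the product, the second the additional \<open>D\<close>.\<close>
  have X1: "D * ?X1 = bracket A 2 3 4 * (D * bracket A 1 5 6) - bracket A 1 3 4 * (D * bracket A 2 5 6)
      + bracket A 1 2 4 * (D * bracket A 3 5 6)"
    unfolding plucker_frame(6) by (simp add: algebra_simps)
  note DX = X1[unfolded D_def plucker_frame(1-5), folded D_def] X[unfolded D_def plucker_frame(1-5), folded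
      D_def]
  \<comment> \<open>Coordinates of the six invariants in the basis of standard tableaux.\<close>
  have J: "joubert A 1 = - 2 * ?X2 + ?X3 + ?X4 + ?X5"
    "joubert A 2 = - 3 * ?X1 + ?X2 - 2 * ?X3 - 2 * ?X4 + ?X5"
    "joubert A 3 = ?X2 + ?X3 - 2 * ?X4 + ?X5"
    "joubert A 4 = 3 * ?X1 - 2 * ?X2 + ?X3 + ?X4 - 2 * ?X5"
    "joubert A 5 = ?X2 - 2 * ?X3 + ?X4 + ?X5"
    "joubert A 6 = ?X2 + ?X3 + ?X4 - 2 * ?X5"
    by (simp_all add: joubert_def joubert_diff_def concurrence_def bracket_sort plucker plucker_commuted
        algebra_simps)
  show "D * joubert A 1 = F - 2*E + 3*a" "D * joubert A 2 = F - 2*E + 3*b" "D * joubert A 6 = F - 2*E + 3*c"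
    "D * joubert A 3 = E - 2*F + 3*x" "D * joubert A 4 = E - 2*F + 3*y" "D * joubert A 5 = E - 2*F + 3*z"
    unfolding J[folded D_def] distrib_left right_diff_distrib mult.left_commute[of D "_ :: 'a"
        "_ * _"] mult_minus_left mult_minus_right DX
    unfolding E_def F_def a_def b_def c_def x_def y_def z_def
    by (simp_all add: algebra_simps)
qed

text \<open>The multiples \<open>D * joubert A i\<close> have the shape treated in
  \<open>quartic_identity\<close>. Passing to them costs the factor \<open>D^4\<close>, which is the
  square of \<open>D^2\<close>, so dividing it out leaves a square.\<close>

lemma joubert_quartic:
  fixes A :: "'a::field^3^6"
  assumes "bracket A 1 2 3 \<noteq> 0"
  shows "\<exists>y. 4 * (\<Sum>i\<in>UNIV. joubert A i ^ 4) - (\<Sum>i\<in>UNIV. joubert A i ^ 2) ^ 2 = y ^ 2"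
proof -
  define D where "D = bracket A 1 2 3"
  obtain a b c x y z where abc: "a * b * c = x * y * z"
    and J: "D * joubert A 1 = x + y + z - 2*(a + b + c) + 3*a"
      "D * joubert A 2 = x + y + z - 2*(a + b + c) + 3*b"
      "D * joubert A 6 = x + y + z - 2*(a + b + c) + 3*c"
      "D * joubert A 3 = a + b + c - 2*(x + y + z) + 3*x"
      "D * joubert A 4 = a + b + c - 2*(x + y + z) + 3*y"
      "D * joubert A 5 = a + b + c - 2*(x + y + z) + 3*z"
    using that[OF _ joubert_frame[of A, folded D_def]] by (simp add: mult.assoc mult.left_commute mult.commute)
  let ?w = "18 * ((a*b+b*c+c*a) - (x*y + y*z + z*x))"
  have "D^4 * (4 * (\<Sum>i\<in>UNIV. joubert A i ^ 4) - (\<Sum>i\<in>UNIV. joubert A i ^ 2) ^ 2) =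
     4 * ((D * joubert A 1)^4 + (D * joubert A 2)^4 + (D * joubert A 6)^4
        + ((D * joubert A 3)^4 + (D * joubert A 4)^4 + (D * joubert A 5)^4))
      - ((D * joubert A 1)^2 + (D * joubert A 2)^2 + (D * joubert A 6)^2
        + ((D * joubert A 3)^2 + (D * joubert A 4)^2 + (D * joubert A 5)^2))^2"
    unfolding sum_6 power_mult_distrib by (simp add: power4_eq_xxxx power2_eq_square algebra_simps)
  also have "\<dots> = ?w^2"
    unfolding J by (rule quartic_identity[OF abc])
  finally have "4 * (\<Sum>i\<in>UNIV. joubert A i ^ 4) - (\<Sum>i\<in>UNIV. joubert A i ^ 2) ^ 2 = ?w^2 / D^4"
    using assms by (simp add: D_def field_simps)
  also have "\<dots> = (?w / D^2)^2"
    by (simp add: power_divide flip: power_mult)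
  finally show ?thesis by blast
qed

section \<open>Non-very generic intersections\<close>

lemma matrix_vector_3: "(A *v v) $ i = A$i$1 * v$1 + A$i$2 * v$2 + A$i$3 * v$3" for A :: "'a::field^3^'n"
  by (simp add: matrix_vector_mult_def sum_3)

lemma bracket_eq_det: "bracket A i j k = det (vector [A$i, A$j, A$k] :: 'a::field^3^3)"
  by (simp add: det_3 vector_3 bracket_def algebra_simps)

lemma bracket_degenerate: "bracket A i i k = 0" "bracket A i j j = 0" "bracket A i j i = 0"
  by (simp_all add: bracket_def algebra_simps)

lemma bracket_rows_eq: "A$i = A$j \<Longrightarrow> bracket A i j k = 0"
  by (simp add: bracket_def algebra_simps)

lemma bracket_swap: "bracket A j i k = - bracket A i j k"
  and bracket_rotate: "bracket A j k i = bracket A i j k"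
  by (simp_all add: bracket_def algebra_simps)

text \<open>The minor is linear in its first row, and putting row \<open>j\<close> or
  \<open>k\<close> there gives 0; hence the relation annihilates all terms but that of
  \<open>u\<close>.\<close>

lemma bracket_cramer:
  assumes "u *s A$i + v *s A$j + w *s A$k = (0 :: 'a::field^3)"
  shows "u * bracket A i j k = 0"
proof -
  have 1: "u * A$i$n + v * A$j$n + w * A$k$n = 0" for n
    using arg_cong[OF assms, of "\<lambda>x. x$n"] by simp
  have "u * bracket A i j k =
     (u * A$i$1 + v * A$j$1 + w * A$k$1) * (A$j$2 * A$k$3 - A$j$3 * A$k$2)
   - (u * A$i$2 + v * A$j$2 + w * A$k$2) * (A$j$1 * A$k$3 - A$j$3 * A$k$1)
   + (u * A$i$3 + v * A$j$3 + w * A$k$3) * (A$j$1 * A$k$2 - A$j$2 * A$k$1)"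
    by (simp add: bracket_def algebra_simps)
  then show ?thesis by (simp add: 1)
qed

lemma bracket_eq_0_imp_dependent:
  assumes "bracket A i j k = (0 :: 'a::field)"
  obtains u v w where "u *s A$i + v *s A$j + w *s A$k = 0" "u \<noteq> 0 \<or> v \<noteq> 0 \<or> w \<noteq> 0"
proof -
  let ?M = "vector [A$i, A$j, A$k] :: 'a^3^3"
  have "\<not> (\<exists>B. ?M ** B = mat 1)"
    using assms invertible_det_nz[of ?M] invertible_right_inverse[of ?M] by (simp add: bracket_eq_det)
  then obtain c n where c: "(\<Sum>i\<in>UNIV. c i *s row i ?M) = 0" "c n \<noteq> 0"
    unfolding matrix_right_invertible_independent_rows by blast
  have r: "row 1 ?M = A$i" "row 2 ?M = A$j" "row 3 ?M = A$k"
    by (simp_all add: row_def vector_3 vec_eq_iff)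
  have "c 1 \<noteq> 0 \<or> c 2 \<noteq> 0 \<or> c 3 \<noteq> 0"
    using c(2) exhaust_3[of n] by auto
  with c(1) that[of "c 1" "c 2" "c 3"] show thesis by (simp add: sum_3 r)
qed

lemma row_eq: "row i A = A$i" by (simp add: row_def vec_eq_iff)

lemma generic_arrangement_iff:
  "generic_arrangement (A :: 'a::field^3^6) \<longleftrightarrow>
    (\<forall>i j k. i \<noteq> j \<longrightarrow> j \<noteq> k \<longrightarrow> i \<noteq> k \<longrightarrow> bracket A i j k \<noteq> 0)"
proof (intro iffI allI impI)
  fix i j k :: 6
  assume gen: "generic_arrangement A" and d: "i \<noteq> j" "j \<noteq> k" "i \<noteq> k"
  have "card {i, j, k} = 3"
    using d by simp
  then have inj: "inj_on (\<lambda>i. A$i) {i, j, k}" and ind: "vec.independent {A$i, A$j, A$k}"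
    using gen unfolding generic_arrangement_def row_eq by fastforce+
  from inj have dd: "A$i \<noteq> A$j" "A$j \<noteq> A$k" "A$i \<noteq> A$k"
    using d by (auto simp: inj_on_def)
  show "bracket A i j k \<noteq> 0"
  proof
    assume "bracket A i j k = 0"
    then obtain u v w where uvw: "u *s A$i + v *s A$j + w *s A$k = 0" "u \<noteq> 0 \<or> v \<noteq> 0 \<or> w \<noteq> 0"
      by (rule bracket_eq_0_imp_dependent)
    \<comment> \<open>\<open>vec.dependent_finite\<close> takes coefficients indexed by vectors
      instead of row numbers; the distinctness \<open>dd\<close> of the rows makes the case
      distinction unambiguous.\<close>
    define f where "f x = (if x = A$i then u else if x = A$j then v else w)" for x
    have "(\<Sum>x\<in>{A$i, A$j, A$k}. f x *s x) = 0"
      using uvw(1) dd by (simp add: f_def add.assoc)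
    moreover have "\<exists>x\<in>{A$i, A$j, A$k}. f x \<noteq> 0"
      using uvw(2) dd by (force simp: f_def)
    ultimately have "vec.dependent {A$i, A$j, A$k}"
      using vec.dependent_finite[of "{A$i, A$j, A$k}"] by auto
    with ind show False by simp
  qed
next
  assume br: "\<forall>i j k. i \<noteq> j \<longrightarrow> j \<noteq> k \<longrightarrow> i \<noteq> k \<longrightarrow> bracket A i j k \<noteq> 0"
  show "generic_arrangement A"
    unfolding generic_arrangement_def row_eq
  proof (intro allI impI)
    fix S :: "6 set"
    assume "card S = 3"
    then obtain i j k where S: "S = {i, j, k}" and d: "i \<noteq> j" "j \<noteq> k" "i \<noteq> k"
      by (metis card_3_iff)
    have dd: "A$i \<noteq> A$j" "A$j \<noteq> A$k" "A$k \<noteq> A$i"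
      using br d bracket_rows_eq by metis+
    have "vec.independent {A$i, A$j, A$k}"
    proof
      assume "vec.dependent {A$i, A$j, A$k}"
      then obtain f where f: "\<exists>x\<in>{A$i, A$j, A$k}. f x \<noteq> 0" "(\<Sum>x\<in>{A$i, A$j, A$k}. f x *s x) = 0"
        using vec.dependent_finite[of "{A$i, A$j, A$k}"] by auto
      have e: "f (A$i) *s A$i + f (A$j) *s A$j + f (A$k) *s A$k = 0"
        using f(2) dd by (simp add: add.assoc)
      have "f (A$i) = 0"
        using bracket_cramer[OF e] br d by auto
      moreover have "f (A$j) = 0"
        using bracket_cramer[of "f (A$j)" A j "f (A$k)" k "f (A$i)" i] e br d by (auto simp: ac_simps)
      moreover have "f (A$k) = 0"
        using bracket_cramer[of "f (A$k)" A k "f (A$i)" i "f (A$j)" j] e br d by (auto simp: ac_simps)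
      ultimately show False using f(1) by auto
    qed
    moreover have "inj_on (\<lambda>i. A$i) S"
      using dd by (auto simp: S inj_on_def)
    ultimately show "inj_on (\<lambda>i. A$i) S \<and> vec.independent ((\<lambda>i. A$i) ` S)"
      by (simp add: S)
  qed
qed

text \<open>Expansion of a vanishing 4x4 determinant: the column of values at \<open>v\<close> is a
  combination of the three columns of coefficients. This is the linear equation satisfied by the
  points of \<open>discr_hyperplane A {p, q, r, s}\<close>.\<close>

lemma bracket_plane:
  fixes A :: "'a::field^3^6"
  shows "(A *v v)$p * bracket A q r s - (A *v v)$q * bracket A p r s
   + (A *v v)$r * bracket A p q s - (A *v v)$s * bracket A p q r = 0"
  by (simp add: matrix_vector_3 bracket_def algebra_simps)

text \<open>The vector \<open>n r s\<close> is the cross product of rows \<open>r\<close> and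
  \<open>s\<close>, a direction vector of the line in which the planes \<open>r\<close> and
  \<open>s\<close> meet.\<close>

lemma bracket_cross:
  fixes A :: "'a::field^3^6"
  defines "n \<equiv> \<lambda>r s. vector [A$r$2 * A$s$3 - A$r$3 * A$s$2, A$r$3 * A$s$1 - A$r$1 * A$s$3, A$r$1 * A$s$2
      - A$r$2 * A$s$1] :: 'a^3"
  shows "(A *v n r s)$p = bracket A p r s"
  by (simp add: matrix_vector_3 n_def vector_3 bracket_def algebra_simps)

lemma bracket_kernel:
  fixes A :: "'a::field^3^6"
  assumes "(A *v v)$i = 0" "(A *v v)$j = 0" "(A *v v)$k = 0" "bracket A i j k \<noteq> 0"
  shows "v = 0"
proof -
  let ?M = "vector [A$i, A$j, A$k] :: 'a^3^3"
  have "?M *v v = 0"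
    using assms by (simp add: vec_eq_iff forall_3 matrix_vector_3 vector_3)
  moreover have "invertible ?M"
    using assms by (simp add: invertible_det_nz bracket_eq_det)
  then obtain B where "B ** ?M = mat 1"
    unfolding invertible_def by blast
  then have "v = B *v (?M *v v)"
    by (simp add: matrix_vector_mul_assoc)
  ultimately show ?thesis
    by simp
qed

lemma discr_hyperplane_iff: "x \<in> discr_hyperplane A L \<longleftrightarrow> (\<exists>v. \<forall>i\<in>L. (A *v v)$i = x$i)"
  by (auto simp: discr_hyperplane_def translate_def)

text \<open>The intersection \<open>V\<close> contains the 3-dimensional image \<open>R\<close> of
  \<open>A\<close>, so its codimension drops below 3 exactly when \<open>V\<close> is larger than
  \<open>R\<close>. Modulo \<open>R\<close> the planes \<open>r\<close>, \<open>s\<close>,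
  \<open>t\<close>, \<open>u\<close> pass through the origin; the two remaining coordinates then
  satisfy two homogeneous linear equations whose determinant is the concurrence up to sign.\<close>

lemma non_very_generic_iff_concurrence:
  fixes A :: "'a::field^3^6"
  assumes gen: "generic_arrangement A" and d: "distinct [p, q, r, s, t, u]" and UN: "{p, q, r, s, t, u} = UNIV"
  shows "non_very_generic A {{p, q, r, s}, {r, s, t, u}, {p, q, t, u}} \<longleftrightarrow> concurrence A p q r s t u = 0"
proof -
  have br: "bracket A i j k \<noteq> 0" if "distinct [i, j, k]" for i j k
    using gen that by (simp add: generic_arrangement_iff)
  define V where "V = \<Inter> (discr_hyperplane A ` {{p, q, r, s}, {r, s, t, u}, {p, q, t, u}})"
  \<comment> \<open>The translates in which all six planes share a point.\<close>
  define R where "R = range ((*v) A)"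
  have V_iff: "x \<in> V \<longleftrightarrow>
     (\<exists>v. (A *v v)$r = x$r \<and> (A *v v)$s = x$s \<and> (A *v v)$t = x$t \<and> (A *v v)$u = x$u) \<and>
     (\<exists>v. (A *v v)$p = x$p \<and> (A *v v)$q = x$q \<and> (A *v v)$r = x$r \<and> (A *v v)$s = x$s) \<and>
     (\<exists>v. (A *v v)$p = x$p \<and> (A *v v)$q = x$q \<and> (A *v v)$t = x$t \<and> (A *v v)$u = x$u)" for x
    by (auto simp: V_def discr_hyperplane_iff)
  have "inj ((*v) A)"
    unfolding vec.inj_iff_eq_0
    using bracket_kernel[of A _ p q r] br[of p q r] d by simp
  then have dimR: "vec.dim R = 3"
    unfolding R_def using vec.dim_image_eq[OF matrix_vector_mul_linear_gen, of A UNIV] vec_dim_card[where 'a='a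
        and 'n=3] by simp
  have "vec.dim V \<ge> 4 \<longleftrightarrow> concurrence A p q r s t u = 0"
  proof
    assume *: "concurrence A p q r s t u = 0"
    \<comment> \<open>The values of the forms \<open>p\<close> and \<open>q\<close> on the direction
      of the line of \<open>r\<close> and \<open>s\<close>, and 0 elsewhere. The planes
      \<open>p\<close>, \<open>q\<close>, \<open>r\<close>, \<open>s\<close> then meet in
      \<open>n r s\<close>, and \<open>r\<close>, \<open>s\<close>, \<open>t\<close>,
      \<open>u\<close> meet in 0.\<close>
    define x where "x = (\<chi> i. if i = p then bracket A p r s else if i = q then bracket A q r s else 0)"
    define n where "n = (\<lambda>r s. vector [A$r$2 * A$s$3 - A$r$3 * A$s$2, A$r$3 * A$s$1
        - A$r$1 * A$s$3, A$r$1 * A$s$2 - A$r$2 * A$s$1] :: 'a^3)"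
    have n: "(A *v n i j)$k = bracket A k i j" for i j k
      unfolding n_def by (rule bracket_cross)
    have xs: "x$p = bracket A p r s" "x$q = bracket A q r s" "x$r = 0" "x$s = 0" "x$t = 0" "x$u = 0"
      using d by (auto simp: x_def)
    have "x \<in> V"
      unfolding V_iff
    proof (intro conjI)
      show "\<exists>v. (A *v v)$r = x$r \<and> (A *v v)$s = x$s \<and> (A *v v)$t = x$t \<and> (A *v v)$u = x$u"
        by (rule exI[of _ 0]) (simp add: xs)
      show "\<exists>v. (A *v v)$p = x$p \<and> (A *v v)$q = x$q \<and> (A *v v)$r = x$r \<and> (A *v v)$s = x$s"
        by (rule exI[of _ "n r s"]) (simp add: xs n bracket_degenerate)
      \<comment> \<open>The point is sought on the line of \<open>t\<close> and \<open>u\<close>.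
        The scaling matches coordinate \<open>p\<close>; coordinate \<open>q\<close> then agrees
        because the concurrence vanishes.\<close>
      show "\<exists>v. (A *v v)$p = x$p \<and> (A *v v)$q = x$q \<and> (A *v v)$t = x$t \<and> (A *v v)$u = x$u"
        using * br[of p t u] d
        by (intro exI[of _ "(bracket A p r s / bracket A p t u) *s n t u"])
           (simp add: xs n bracket_degenerate matrix_vector_mult_scaleR vec.scale concurrence_def field_simps)
    qed
    moreover have "R \<subseteq> V"
      by (auto simp: R_def V_iff)
    ultimately have "insert x R \<subseteq> V" by simp
    moreover have "x \<notin> R"
    proof
      assume "x \<in> R"
      then obtain v where v: "x = A *v v" by (auto simp: R_def)
      then have "v = 0"
        using bracket_kernel[of A v r s t] xs br[of r s t] d by simp
      with v xs(1) br[of p r s] d show False by simp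
    qed
    moreover have "vec.span R = R"
      unfolding R_def by (simp add: vec.span_image vec.linear_subspace_image vec.span_eq_iff)
    ultimately have "x \<notin> vec.span R"
      by metis
    then have "vec.dim (insert x R) = 4"
      by (simp add: vec.dim_insert dimR)
    with \<open>insert x R \<subseteq> V\<close> show "vec.dim V \<ge> 4"
      using vec.dim_subset by metis
  next
    assume "vec.dim V \<ge> 4"
    show "concurrence A p q r s t u = 0"
    proof (rule ccontr)
      assume *: "concurrence A p q r s t u \<noteq> 0"
      have "V \<subseteq> R"
      proof
        fix x assume "x \<in> V"
        then obtain v0 v1 v2 where
          v0: "(A *v v0)$r = x$r" "(A *v v0)$s = x$s" "(A *v v0)$t = x$t" "(A *v v0)$u = x$u" and
          v1: "(A *v v1)$p = x$p" "(A *v v1)$q = x$q" "(A *v v1)$r = x$r" "(A *v v1)$s = x$s" and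
          v2: "(A *v v2)$p = x$p" "(A *v v2)$q = x$q" "(A *v v2)$t = x$t" "(A *v v2)$u = x$u"
          unfolding V_iff by blast
        \<comment> \<open>The offsets of the planes \<open>p\<close> and \<open>q\<close> from the
          common point \<open>v0\<close> of the other four. Each of the other two quadruples gives a
          linear equation between them.\<close>
        define a b where "a = x$p - (A *v v0)$p" and "b = x$q - (A *v v0)$q"
        have 1: "a * bracket A q r s = b * bracket A p r s"
          using bracket_plane[of A "v1 - v0" p q r s] v0 v1
              by (simp add: a_def b_def matrix_vector_mult_diff_distrib)
        have 2: "a * bracket A q t u = b * bracket A p t u"
          using bracket_plane[of A "v2 - v0" p q t u] v0 v2
              by (simp add: a_def b_def matrix_vector_mult_diff_distrib)
        have "a * concurrence A p q r s t u = bracket A p r s * (a * bracket A q t u)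
            - (a * bracket A q r s) * bracket A p t u"
          by (simp add: concurrence_def algebra_simps)
        also have "\<dots> = 0" unfolding 1 2 by simp
        finally have a: "a = 0" using * by simp
        have "b * concurrence A p q r s t u = (b * bracket A p r s) * bracket A q t u
            - bracket A q r s * (b * bracket A p t u)"
          by (simp add: concurrence_def algebra_simps)
        also have "\<dots> = 0" by (simp flip: 1 2)
        finally have b: "b = 0" using * by simp
        have "x$i = (A *v v0)$i" for i
        proof -
          have "i \<in> {p, q, r, s, t, u}"
            by (simp only: UN UNIV_I)
          then show ?thesis
            using v0 a b by (auto simp: a_def b_def)
        qed
        then have "x = A *v v0" by (simp add: vec_eq_iff)
        then show "x \<in> R" by (simp add: R_def)
      qed
      then have "vec.dim V \<le> 3"
        using vec.dim_subset dimR by metis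
      with \<open>vec.dim V \<ge> 4\<close> show False by simp
    qed
  qed
  moreover have "vec.dim V \<le> 6"
    using vec.dim_subset[of V UNIV] vec_dim_card[where 'a='a and 'n=6] by simp
  ultimately show ?thesis
    unfolding non_very_generic_def codim_def V_def[symmetric] by auto
qed

section \<open>The outer automorphism\<close>

lemma is_phi_comp:
  assumes "is_phi \<phi>" "bij f" "bij g"
  shows "\<phi> (f \<circ> g) = \<phi> f \<circ> \<phi> g"
proof -
  have B: "f \<in> Bij UNIV" "g \<in> Bij UNIV"
    using assms by (auto simp: Bij_def)
  have hom: "\<phi> \<in> hom (BijGroup UNIV) (BijGroup UNIV)"
    using assms(1) by (simp add: is_phi_def auto_def)
  then have C: "\<phi> f \<in> Bij UNIV" "\<phi> g \<in> Bij UNIV"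
    using B by (auto simp: hom_def BijGroup_def)
  have "\<phi> (f \<otimes>\<^bsub>BijGroup UNIV\<^esub> g) = \<phi> f \<otimes>\<^bsub>BijGroup UNIV\<^esub> \<phi> g"
    using hom B by (simp add: hom_def BijGroup_def)
  then show ?thesis
    using B C by (simp add: BijGroup_def compose_def comp_def restrict_def)
qed

lemma is_phi_inj:
  assumes "is_phi \<phi>" "bij f" "bij g" "\<phi> f = \<phi> g"
  shows "f = g"
proof -
  have "inj_on \<phi> (Bij UNIV)"
    using assms(1) by (auto simp: is_phi_def auto_def Bij_def BijGroup_def bij_betw_def)
  with assms show ?thesis
    by (auto simp: Bij_def inj_on_def)
qed

lemma ext_6:
  assumes "f 1 = g 1" "f 2 = g 2" "f 3 = g 3" "f 4 = g 4" "f 5 = g 5" "f (6 :: 6) = g 6"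
  shows "f = g"
  using assms by (simp add: fun_eq_iff forall_6)

lemma transpose_disjoint_commute:
  assumes "{p, q} \<inter> {r, s} = {}"
  shows "Transposition.transpose p q \<circ> Transposition.transpose r s
      = Transposition.transpose r s \<circ> Transposition.transpose p q"
  using assms by (auto simp: fun_eq_iff Transposition.transpose_def)

text \<open>The ten values not given follow from (i k) = (i j)(j k)(i j) and multiplicativity, for
  increasing distance between the two indices.\<close>

lemma phi_transp:
  assumes "is_phi \<phi>"
  shows "\<phi> (transp 1 2) = transp 1 5 \<circ> transp 2 6 \<circ> transp 3 4"
    and "\<phi> (transp 1 3) = transp 1 4 \<circ> transp 2 3 \<circ> transp 5 6"
    and "\<phi> (transp 1 4) = transp 1 3 \<circ> transp 2 5 \<circ> transp 4 6"
    and "\<phi> (transp 1 5) = transp 1 2 \<circ> transp 3 6 \<circ> transp 4 5"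
    and "\<phi> (transp 1 6) = transp 1 6 \<circ> transp 2 4 \<circ> transp 3 5"
    and "\<phi> (transp 2 3) = transp 1 2 \<circ> transp 3 5 \<circ> transp 4 6"
    and "\<phi> (transp 2 4) = transp 1 6 \<circ> transp 2 3 \<circ> transp 4 5"
    and "\<phi> (transp 2 5) = transp 1 3 \<circ> transp 2 4 \<circ> transp 5 6"
    and "\<phi> (transp 2 6) = transp 1 4 \<circ> transp 2 5 \<circ> transp 3 6"
    and "\<phi> (transp 3 4) = transp 1 5 \<circ> transp 2 4 \<circ> transp 3 6"
    and "\<phi> (transp 3 5) = transp 1 6 \<circ> transp 2 5 \<circ> transp 3 4"
    and "\<phi> (transp 3 6) = transp 1 3 \<circ> transp 2 6 \<circ> transp 4 5"
    and "\<phi> (transp 4 5) = transp 1 4 \<circ> transp 2 6 \<circ> transp 3 5"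
    and "\<phi> (transp 4 6) = transp 1 2 \<circ> transp 3 4 \<circ> transp 5 6"
    and "\<phi> (transp 5 6) = transp 1 5 \<circ> transp 2 3 \<circ> transp 4 6"
proof -
  have step: "\<phi> (transp i k) = f"
    if "i \<noteq> j" "j \<noteq> k" "i \<noteq> k" "\<phi> (transp i j) \<circ> \<phi> (transp j k) \<circ> \<phi> (transp i j) = f" for i j k f
  proof -
    have "transp i k = transp i j \<circ> transp j k \<circ> transp i j"
      using that(1-3) by (auto simp: fun_eq_iff Transposition.transpose_def)
    then show ?thesis
      using that(4) by (simp add: is_phi_comp[OF assms] bij_comp)
  qed
  have p12: "\<phi> (transp 1 2) = transp 1 5 \<circ> transp 2 6 \<circ> transp 3 4"
    using assms by (simp add: is_phi_def)
  have p23: "\<phi> (transp 2 3) = transp 1 2 \<circ> transp 3 5 \<circ> transp 4 6"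
    using assms by (simp add: is_phi_def)
  have p34: "\<phi> (transp 3 4) = transp 1 5 \<circ> transp 2 4 \<circ> transp 3 6"
    using assms by (simp add: is_phi_def)
  have p45: "\<phi> (transp 4 5) = transp 1 4 \<circ> transp 2 6 \<circ> transp 3 5"
    using assms by (simp add: is_phi_def)
  have p56: "\<phi> (transp 5 6) = transp 1 5 \<circ> transp 2 3 \<circ> transp 4 6"
    using assms by (simp add: is_phi_def)
  have p13: "\<phi> (transp 1 3) = transp 1 4 \<circ> transp 2 3 \<circ> transp 5 6"
    by (rule step[of 1 2 3], simp, simp, simp, unfold p12 p23, rule ext_6)
      (simp_all add: Transposition.transpose_def)
  have p24: "\<phi> (transp 2 4) = transp 1 6 \<circ> transp 2 3 \<circ> transp 4 5"
    by (rule step[of 2 3 4], simp, simp, simp, unfold p23 p34, rule ext_6)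
      (simp_all add: Transposition.transpose_def)
  have p35: "\<phi> (transp 3 5) = transp 1 6 \<circ> transp 2 5 \<circ> transp 3 4"
    by (rule step[of 3 4 5], simp, simp, simp, unfold p34 p45, rule ext_6)
      (simp_all add: Transposition.transpose_def)
  have p46: "\<phi> (transp 4 6) = transp 1 2 \<circ> transp 3 4 \<circ> transp 5 6"
    by (rule step[of 4 5 6], simp, simp, simp, unfold p45 p56, rule ext_6)
      (simp_all add: Transposition.transpose_def)
  have p14: "\<phi> (transp 1 4) = transp 1 3 \<circ> transp 2 5 \<circ> transp 4 6"
    by (rule step[of 1 3 4], simp, simp, simp, unfold p13 p34, rule ext_6)
      (simp_all add: Transposition.transpose_def)
  have p25: "\<phi> (transp 2 5) = transp 1 3 \<circ> transp 2 4 \<circ> transp 5 6"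
    by (rule step[of 2 4 5], simp, simp, simp, unfold p24 p45, rule ext_6)
      (simp_all add: Transposition.transpose_def)
  have p36: "\<phi> (transp 3 6) = transp 1 3 \<circ> transp 2 6 \<circ> transp 4 5"
    by (rule step[of 3 5 6], simp, simp, simp, unfold p35 p56, rule ext_6)
      (simp_all add: Transposition.transpose_def)
  have p15: "\<phi> (transp 1 5) = transp 1 2 \<circ> transp 3 6 \<circ> transp 4 5"
    by (rule step[of 1 4 5], simp, simp, simp, unfold p14 p45, rule ext_6)
      (simp_all add: Transposition.transpose_def)
  have p26: "\<phi> (transp 2 6) = transp 1 4 \<circ> transp 2 5 \<circ> transp 3 6"
    by (rule step[of 2 5 6], simp, simp, simp, unfold p25 p56, rule ext_6)
      (simp_all add: Transposition.transpose_def)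
  have p16: "\<phi> (transp 1 6) = transp 1 6 \<circ> transp 2 4 \<circ> transp 3 5"
    by (rule step[of 1 5 6], simp, simp, simp, unfold p15 p56, rule ext_6)
      (simp_all add: Transposition.transpose_def)
  show "\<phi> (transp 1 2) = transp 1 5 \<circ> transp 2 6 \<circ> transp 3 4"
      "\<phi> (transp 1 3) = transp 1 4 \<circ> transp 2 3 \<circ> transp 5 6"
      "\<phi> (transp 1 4) = transp 1 3 \<circ> transp 2 5 \<circ> transp 4 6"
      "\<phi> (transp 1 5) = transp 1 2 \<circ> transp 3 6 \<circ> transp 4 5"
      "\<phi> (transp 1 6) = transp 1 6 \<circ> transp 2 4 \<circ> transp 3 5"
      "\<phi> (transp 2 3) = transp 1 2 \<circ> transp 3 5 \<circ> transp 4 6"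
      "\<phi> (transp 2 4) = transp 1 6 \<circ> transp 2 3 \<circ> transp 4 5"
      "\<phi> (transp 2 5) = transp 1 3 \<circ> transp 2 4 \<circ> transp 5 6"
      "\<phi> (transp 2 6) = transp 1 4 \<circ> transp 2 5 \<circ> transp 3 6"
      "\<phi> (transp 3 4) = transp 1 5 \<circ> transp 2 4 \<circ> transp 3 6"
      "\<phi> (transp 3 5) = transp 1 6 \<circ> transp 2 5 \<circ> transp 3 4"
      "\<phi> (transp 3 6) = transp 1 3 \<circ> transp 2 6 \<circ> transp 4 5"
      "\<phi> (transp 4 5) = transp 1 4 \<circ> transp 2 6 \<circ> transp 3 5"
      "\<phi> (transp 4 6) = transp 1 2 \<circ> transp 3 4 \<circ> transp 5 6"
      "\<phi> (transp 5 6) = transp 1 5 \<circ> transp 2 3 \<circ> transp 4 6"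
    by (rule p12 p13 p14 p15 p16 p23 p24 p25 p26 p34 p35 p36 p45 p46 p56)+
qed

lemma corresponds_transp:
  assumes "is_phi \<phi>" "i \<noteq> j"
  shows "\<exists>T. corresponds (\<phi> (transp i j)) T"
proof -
  define P where "P i j \<longleftrightarrow> (\<exists>T. corresponds (\<phi> (transp i j)) T)" for i j
  have sym: "P j i" if "P i j" for i j
    using that by (simp add: P_def Transposition.transpose_commute)
  have intro: "P i j" if "\<phi> (transp i j) = transp p q \<circ> transp r s \<circ> transp t u"
      "{p, q, r, s, t, u} = UNIV" for i j p q r s t u
    using that unfolding corresponds_def P_def by blast
  have P: "P 1 2" "P 1 3" "P 1 4" "P 1 5" "P 1 6" "P 2 3" "P 2 4" "P 2 5" "P 2 6" "P 3 4" "P 3 5" "P 3 6"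
      "P 4 5" "P 4 6" "P 5 6"
    by (rule intro, rule phi_transp[OF assms(1)], auto simp: UNIV_6)+
  have "P i j"
    using assms(2) exhaust_6[of i] exhaust_6[of j] by (elim disjE) (simp_all add: P P[THEN sym])
  then show ?thesis
    by (simp add: P_def)
qed

text \<open>The correspondence allows the three pairs in any order and each pair in either
  orientation. The relation \<open>R\<close> is closed under these changes, so
  \<open>\<sigma>\<close> and \<open>T\<close> can be brought to one of fifteen standard forms, one
  for each edge.\<close>

lemma non_very_generic_iff_joubert:
  fixes A :: "'a::field^3^6"
  assumes gen: "generic_arrangement A" and three: "(3::'a) \<noteq> 0" and phi: "is_phi \<phi>" and cor: "corresponds \<sigma> T"
  shows "\<exists>i j. i \<noteq> j \<and> \<sigma> = \<phi> (transp i j) \<and> (non_very_generic A T \<longleftrightarrow> joubert A i = joubert A j)"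
proof -
  define R where "R p q r s t u \<longleftrightarrow> {p, q, r, s, t, u} = UNIV \<and> distinct [p, q, r, s, t, u] \<and>
     \<sigma> = transp p q \<circ> transp r s \<circ> transp t u \<and>
     T = {{p, q, r, s}, {r, s, t, u}, {p, q, t, u}}" for p q r s t u
  have edge: ?thesis
    if "R p q r s t u" "i \<noteq> j" "\<phi> (transp i j) = transp p q \<circ> transp r s \<circ> transp t u"
      "3 * concurrence A p q r s t u = joubert A i - joubert A j \<or> 3 * concurrence A p q r s t u = joubert A j
          - joubert A i"
    for p q r s t u i j
  proof -
    have "non_very_generic A T \<longleftrightarrow> concurrence A p q r s t u = 0"
      using that(1) non_very_generic_iff_concurrence[OF gen, of p q r s t u] by (simp add: R_def)
    also have "\<dots> \<longleftrightarrow> 3 * concurrence A p q r s t u = 0"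
      using three by simp
    also have "\<dots> \<longleftrightarrow> joubert A i = joubert A j"
      using that(4) by auto
    finally have "non_very_generic A T \<longleftrightarrow> joubert A i = joubert A j" .
    moreover have "\<sigma> = \<phi> (transp i j)"
      using that(1,3) by (simp add: R_def)
    ultimately show ?thesis
      using that(2) by blast
  qed
  have k12: ?thesis if "R 1 5 2 6 3 4"
    by (rule edge[OF that _ phi_transp(1)[OF phi]]) (simp_all add: concurrence_joubert(1))
  have k13: ?thesis if "R 1 4 2 3 5 6"
    by (rule edge[OF that _ phi_transp(2)[OF phi]]) (simp_all add: concurrence_joubert(2))
  have k14: ?thesis if "R 1 3 2 5 4 6"
    by (rule edge[OF that _ phi_transp(3)[OF phi]]) (simp_all add: concurrence_joubert(3))
  have k15: ?thesis if "R 1 2 3 6 4 5"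
    by (rule edge[OF that _ phi_transp(4)[OF phi]]) (simp_all add: concurrence_joubert(4))
  have k16: ?thesis if "R 1 6 2 4 3 5"
    by (rule edge[OF that _ phi_transp(5)[OF phi]]) (simp_all add: concurrence_joubert(5))
  have k23: ?thesis if "R 1 2 3 5 4 6"
    by (rule edge[OF that _ phi_transp(6)[OF phi]]) (simp_all add: concurrence_joubert(6))
  have k24: ?thesis if "R 1 6 2 3 4 5"
    by (rule edge[OF that _ phi_transp(7)[OF phi]]) (simp_all add: concurrence_joubert(7))
  have k25: ?thesis if "R 1 3 2 4 5 6"
    by (rule edge[OF that _ phi_transp(8)[OF phi]]) (simp_all add: concurrence_joubert(8))
  have k26: ?thesis if "R 1 4 2 5 3 6"
    by (rule edge[OF that _ phi_transp(9)[OF phi]]) (simp_all add: concurrence_joubert(9))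
  have k34: ?thesis if "R 1 5 2 4 3 6"
    by (rule edge[OF that _ phi_transp(10)[OF phi]]) (simp_all add: concurrence_joubert(10))
  have k35: ?thesis if "R 1 6 2 5 3 4"
    by (rule edge[OF that _ phi_transp(11)[OF phi]]) (simp_all add: concurrence_joubert(11))
  have k36: ?thesis if "R 1 3 2 6 4 5"
    by (rule edge[OF that _ phi_transp(12)[OF phi]]) (simp_all add: concurrence_joubert(12))
  have k45: ?thesis if "R 1 4 2 6 3 5"
    by (rule edge[OF that _ phi_transp(13)[OF phi]]) (simp_all add: concurrence_joubert(13))
  have k46: ?thesis if "R 1 2 3 4 5 6"
    by (rule edge[OF that _ phi_transp(14)[OF phi]]) (simp_all add: concurrence_joubert(14))
  have k56: ?thesis if "R 1 5 2 3 4 6"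
    by (rule edge[OF that _ phi_transp(15)[OF phi]]) (simp_all add: concurrence_joubert(15))
  note keys = k12 k13 k14 k15 k16 k23 k24 k25 k26 k34 k35 k36 k45 k46 k56
  have sets: "{a, b, c, d} = {b, a, c, d}" "{a, b, c, d} = {c, d, a, b}"
      "{a, b, c, d, e, f} = {b, a, c, d, e, f}"
    "{a, b, c, d, e, f} = {c, d, a, b, e, f}" "{a, b, c, d, e, f} = {a, b, e, f, c, d}"
    "{x, y, z} = {x, z, y}" "{x, y, z} = {z, y, x}" for a b c d e f :: 6 and x y z :: "6 set"
    by auto
  have swap1: "R q p r s t u" if "R p q r s t u" for p q r s t u
    using that unfolding R_def Transposition.transpose_commute[of q p] sets(1)[of q p] sets(3)[of q p]
        by simp blast
  have swap2: "R r s p q t u" if "R p q r s t u" for p q r s t u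
  proof -
    have "transp p q \<circ> transp r s = transp r s \<circ> transp p q"
      using that by (intro transpose_disjoint_commute) (auto simp: R_def)
    then show ?thesis
      using that unfolding R_def sets(2)[of r s p q] sets(4)[of r s p q] sets(6)[of _ "{p, q, t, u}"]
          by (simp; blast)
  qed
  have swap3: "R p q t u r s" if "R p q r s t u" for p q r s t u
  proof -
    have "transp r s \<circ> transp t u = transp t u \<circ> transp r s"
      using that by (intro transpose_disjoint_commute) (auto simp: R_def)
    then have "transp p q \<circ> transp r s \<circ> transp t u = transp p q \<circ> transp t u \<circ> transp r s"
      by (simp only: o_assoc[symmetric])
    then show ?thesis
      using that unfolding R_def sets(2)[of t u r s] sets(5)[of p q t u r s] sets(7)[of "{p, q, t, u}"]
          by (simp; blast)
  qed
  have swap4: "R p q r s u t" if "R p q r s t u" for p q r s t u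
    by (rule swap3[OF swap2[OF swap1[OF swap2[OF swap3[OF that]]]]])
  obtain p q r s t u where R: "R p q r s t u"
  proof -
    from cor obtain p q r s t u where "{p, q, r, s, t, u} = UNIV"
       "\<sigma> = transp p q \<circ> transp r s \<circ> transp t u" "T = {{p, q, r, s}, {r, s, t, u}, {p, q, t, u}}"
      unfolding corresponds_def by blast
    \<comment> \<open>Six entries that exhaust a type with six elements are distinct.\<close>
    moreover from this(1) have "card (set [p, q, r, s, t, u]) = length [p, q, r, s, t, u]"
      by simp
    then have "distinct [p, q, r, s, t, u]"
      by (rule card_distinct)
    ultimately show thesis
      using that unfolding R_def by blast
  qed
  have "1 = p \<or> 1 = q \<or> 1 = r \<or> 1 = s \<or> 1 = t \<or> 1 = u"
    using R unfolding R_def by (metis UNIV_I empty_iff insert_iff)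
  then have "\<exists>q r s t u. R 1 q r s t u"
    using R swap1[OF R] swap2[OF R] swap1[OF swap2[OF R]] swap2[OF swap3[OF R]] swap1[OF swap2[OF swap3[OF R]]]
    by metis
  then obtain q r s t u where R: "R 1 q r s t u" by blast
  \<comment> \<open>Normalise so that the first pair contains \<open>1\<close> and the second one the least remaining index \<open>m\<close>.\<close>
  define m where "m = (if q = 2 then 3 else 2 :: 6)"
  have "m \<noteq> 1" "m \<noteq> q"
    by (auto simp: m_def)
  then have "m = r \<or> m = s \<or> m = t \<or> m = u"
    using R unfolding R_def by (metis UNIV_I empty_iff insert_iff)
  then have "\<exists>s t u. R 1 q m s t u"
    using R swap2[OF swap1[OF swap2[OF R]]] swap3[OF R] swap3[OF swap4[OF R]] by metis
  then obtain s t u where R: "R 1 q m s t u" by blast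
  then have d: "distinct [1, q, m, s, t, u]" by (simp add: R_def)
  then consider "q = 2" | "q = 3" | "q = 4" | "q = 5" | "q = 6"
    using exhaust_6[of q] by auto
  then show ?thesis
  proof cases
    case 1
    then have "m = 3" by (simp add: m_def)
    have "(s, t, u) \<in> {(4, 5, 6), (4, 6, 5), (5, 4, 6), (5, 6, 4), (6, 4, 5), (6, 5, 4)}"
      using d exhaust_6[of s] exhaust_6[of t] exhaust_6[of u] unfolding \<open>q = 2\<close> \<open>m = 3\<close> by auto
    then show ?thesis
      using R swap4[OF R] keys unfolding \<open>q = 2\<close> \<open>m = 3\<close> by auto
  next
    case 2
    then have "m = 2" by (simp add: m_def)
    have "(s, t, u) \<in> {(4, 5, 6), (4, 6, 5), (5, 4, 6), (5, 6, 4), (6, 4, 5), (6, 5, 4)}"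
      using d exhaust_6[of s] exhaust_6[of t] exhaust_6[of u] unfolding \<open>q = 3\<close> \<open>m = 2\<close> by auto
    then show ?thesis
      using R swap4[OF R] keys unfolding \<open>q = 3\<close> \<open>m = 2\<close> by auto
  next
    case 3
    then have "m = 2" by (simp add: m_def)
    have "(s, t, u) \<in> {(3, 5, 6), (3, 6, 5), (5, 3, 6), (5, 6, 3), (6, 3, 5), (6, 5, 3)}"
      using d exhaust_6[of s] exhaust_6[of t] exhaust_6[of u] unfolding \<open>q = 4\<close> \<open>m = 2\<close> by auto
    then show ?thesis
      using R swap4[OF R] keys unfolding \<open>q = 4\<close> \<open>m = 2\<close> by auto
  next
    case 4
    then have "m = 2" by (simp add: m_def)
    have "(s, t, u) \<in> {(3, 4, 6), (3, 6, 4), (4, 3, 6), (4, 6, 3), (6, 3, 4), (6, 4, 3)}"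
      using d exhaust_6[of s] exhaust_6[of t] exhaust_6[of u] unfolding \<open>q = 5\<close> \<open>m = 2\<close> by auto
    then show ?thesis
      using R swap4[OF R] keys unfolding \<open>q = 5\<close> \<open>m = 2\<close> by auto
  next
    case 5
    then have "m = 2" by (simp add: m_def)
    have "(s, t, u) \<in> {(3, 4, 5), (3, 5, 4), (4, 3, 5), (4, 5, 3), (5, 3, 4), (5, 4, 3)}"
      using d exhaust_6[of s] exhaust_6[of t] exhaust_6[of u] unfolding \<open>q = 6\<close> \<open>m = 2\<close> by auto
    then show ?thesis
      using R swap4[OF R] keys unfolding \<open>q = 6\<close> \<open>m = 2\<close> by auto
  qed
qed

section \<open>The type of an arrangement\<close>

text \<open>\<open>swap\<close> and \<open>rotate\<close> generate all orders of a triple, which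
  leaves the twenty increasing triples.\<close>

lemma triples_6:
  assumes "i \<noteq> j" "j \<noteq> k" "i \<noteq> (k :: 6)"
    and swap: "\<And>i j k. Q i j k \<Longrightarrow> Q j i k" and rotate: "\<And>i j k. Q i j k \<Longrightarrow> Q j k i"
    and Q: "Q 1 2 3" "Q 1 2 4" "Q 1 2 5" "Q 1 2 6" "Q 1 3 4" "Q 1 3 5" "Q 1 3 6" "Q 1 4 5" "Q 1 4 6" "Q 1 5 6"
        "Q 2 3 4" "Q 2 3 5" "Q 2 3 6" "Q 2 4 5" "Q 2 4 6" "Q 2 5 6" "Q 3 4 5" "Q 3 4 6" "Q 3 5 6" "Q 4 5 6"
  shows "Q i j k"
proof -
  note R = Q Q[THEN rotate] Q[THEN rotate, THEN rotate]
  note S = R R[THEN swap]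
  show ?thesis
    using assms(1-3) exhaust_6[of i] exhaust_6[of j] exhaust_6[of k]
    by (elim disjE) (simp_all add: S)
qed

lemma joubert_triple_nonzero_iff:
  fixes A :: "'a::field^3^6"
  assumes "(3::'a) \<noteq> 0"
  shows "joubert A 3 + joubert A 4 + joubert A 5 \<noteq> 0 \<longleftrightarrow> bracket A 1 2 3 \<noteq> 0 \<and> bracket A 4 5 6 \<noteq> 0"
    and "joubert A 3 + joubert A 5 + joubert A 6 \<noteq> 0 \<longleftrightarrow> bracket A 1 2 4 \<noteq> 0 \<and> bracket A 3 5 6 \<noteq> 0"
    and "joubert A 1 + joubert A 3 + joubert A 6 \<noteq> 0 \<longleftrightarrow> bracket A 1 2 5 \<noteq> 0 \<and> bracket A 3 4 6 \<noteq> 0"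
    and "joubert A 1 + joubert A 3 + joubert A 4 \<noteq> 0 \<longleftrightarrow> bracket A 1 2 6 \<noteq> 0 \<and> bracket A 3 4 5 \<noteq> 0"
    and "joubert A 1 + joubert A 5 + joubert A 6 \<noteq> 0 \<longleftrightarrow> bracket A 1 3 4 \<noteq> 0 \<and> bracket A 2 5 6 \<noteq> 0"
    and "joubert A 1 + joubert A 3 + joubert A 5 \<noteq> 0 \<longleftrightarrow> bracket A 1 3 5 \<noteq> 0 \<and> bracket A 2 4 6 \<noteq> 0"
    and "joubert A 1 + joubert A 2 + joubert A 3 \<noteq> 0 \<longleftrightarrow> bracket A 1 3 6 \<noteq> 0 \<and> bracket A 2 4 5 \<noteq> 0"
    and "joubert A 2 + joubert A 3 + joubert A 5 \<noteq> 0 \<longleftrightarrow> bracket A 1 4 5 \<noteq> 0 \<and> bracket A 2 3 6 \<noteq> 0"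
    and "joubert A 1 + joubert A 2 + joubert A 5 \<noteq> 0 \<longleftrightarrow> bracket A 1 4 6 \<noteq> 0 \<and> bracket A 2 3 5 \<noteq> 0"
    and "joubert A 1 + joubert A 4 + joubert A 5 \<noteq> 0 \<longleftrightarrow> bracket A 1 5 6 \<noteq> 0 \<and> bracket A 2 3 4 \<noteq> 0"
  using assms by (simp_all flip: bracket_joubert)

text \<open>Complementary triples have opposite sums because all six invariants sum to 0. With the
  ten triples of \<open>bracket_joubert\<close> this covers all twenty.\<close>

lemma joubert_triple_complement:
  shows "joubert A 1 + joubert A 2 + joubert A 6 = - (joubert A 3 + joubert A 4 + joubert A 5)"
    and "joubert A 1 + joubert A 2 + joubert A 4 = - (joubert A 3 + joubert A 5 + joubert A 6)"
    and "joubert A 2 + joubert A 4 + joubert A 5 = - (joubert A 1 + joubert A 3 + joubert A 6)"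
    and "joubert A 2 + joubert A 5 + joubert A 6 = - (joubert A 1 + joubert A 3 + joubert A 4)"
    and "joubert A 2 + joubert A 3 + joubert A 4 = - (joubert A 1 + joubert A 5 + joubert A 6)"
    and "joubert A 2 + joubert A 4 + joubert A 6 = - (joubert A 1 + joubert A 3 + joubert A 5)"
    and "joubert A 4 + joubert A 5 + joubert A 6 = - (joubert A 1 + joubert A 2 + joubert A 3)"
    and "joubert A 1 + joubert A 4 + joubert A 6 = - (joubert A 2 + joubert A 3 + joubert A 5)"
    and "joubert A 3 + joubert A 4 + joubert A 6 = - (joubert A 1 + joubert A 2 + joubert A 5)"
    and "joubert A 2 + joubert A 3 + joubert A 6 = - (joubert A 1 + joubert A 4 + joubert A 5)"
  by (rule minus_unique[symmetric], insert sum_joubert[of A], simp only: ac_simps)+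

text \<open>Ten complementary pairs of minors face ten complementary pairs of triple sums: a sum
  vanishes iff the product of the corresponding two minors does, as 3 is invertible.\<close>

lemma generic_arrangement_iff_joubert:
  fixes A :: "'a::field^3^6"
  assumes three: "(3::'a) \<noteq> 0"
  shows "generic_arrangement A \<longleftrightarrow>
    (\<forall>i j k. i \<noteq> j \<longrightarrow> j \<noteq> k \<longrightarrow> i \<noteq> k \<longrightarrow> joubert A i + joubert A j + joubert A k \<noteq> 0)"
proof (intro iffI allI impI)
  fix i j k :: 6
  assume gen: "generic_arrangement A" and d: "i \<noteq> j" "j \<noteq> k" "i \<noteq> k"
  have br: "bracket A i j k \<noteq> 0" if "i \<noteq> j" "j \<noteq> k" "i \<noteq> k" for i j k
    using gen that by (simp add: generic_arrangement_iff)
  have J: "joubert A 3 + joubert A 4 + joubert A 5 \<noteq> 0" "joubert A 3 + joubert A 5 + joubert A 6 \<noteq> 0"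
      "joubert A 1 + joubert A 3 + joubert A 6 \<noteq> 0" "joubert A 1 + joubert A 3 + joubert A 4 \<noteq> 0"
      "joubert A 1 + joubert A 5 + joubert A 6 \<noteq> 0" "joubert A 1 + joubert A 3 + joubert A 5 \<noteq> 0"
      "joubert A 1 + joubert A 2 + joubert A 3 \<noteq> 0" "joubert A 2 + joubert A 3 + joubert A 5 \<noteq> 0"
      "joubert A 1 + joubert A 2 + joubert A 5 \<noteq> 0" "joubert A 1 + joubert A 4 + joubert A 5 \<noteq> 0"
    by (simp_all only: joubert_triple_nonzero_iff[OF three]) (simp_all add: br)
  then have J': "joubert A 1 + joubert A 2 + joubert A 6 \<noteq> 0" "joubert A 1 + joubert A 2 + joubert A 4 \<noteq> 0"
      "joubert A 2 + joubert A 4 + joubert A 5 \<noteq> 0" "joubert A 2 + joubert A 5 + joubert A 6 \<noteq> 0"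
      "joubert A 2 + joubert A 3 + joubert A 4 \<noteq> 0" "joubert A 2 + joubert A 4 + joubert A 6 \<noteq> 0"
      "joubert A 4 + joubert A 5 + joubert A 6 \<noteq> 0" "joubert A 1 + joubert A 4 + joubert A 6 \<noteq> 0"
      "joubert A 3 + joubert A 4 + joubert A 6 \<noteq> 0" "joubert A 2 + joubert A 3 + joubert A 6 \<noteq> 0"
    by (simp_all only: joubert_triple_complement neg_equal_0_iff_equal simp_thms)
  show "joubert A i + joubert A j + joubert A k \<noteq> 0"
    \<comment> \<open>The facts are listed in the lexicographic order of the triples, from 123 to
      456.\<close>
    by (rule triples_6[where Q = "\<lambda>i j k. joubert A i + joubert A j
        + joubert A k \<noteq> 0", OF d _ _ J(7) J'(2) J(9) J'(1) J(4) J(6) J(3) J(10) J'(8) J(5) J'(5) J(8) J'(10)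
        J'(3) J'(6) J'(4) J(1) J'(9) J(2) J'(7)])
       (simp_all only: ac_simps simp_thms)
next
  assume "\<forall>i j k. i \<noteq> j \<longrightarrow> j \<noteq> k \<longrightarrow> i \<noteq> k \<longrightarrow> joubert A i + joubert A j + joubert A k \<noteq> 0"
  then have "joubert A i + joubert A j + joubert A k \<noteq> 0" if "i \<noteq> j" "j \<noteq> k" "i \<noteq> k" for i j k
    using that by blast
  then have J: "joubert A 3 + joubert A 4 + joubert A 5 \<noteq> 0" "joubert A 3 + joubert A 5 + joubert A 6 \<noteq> 0"
      "joubert A 1 + joubert A 3 + joubert A 6 \<noteq> 0" "joubert A 1 + joubert A 3 + joubert A 4 \<noteq> 0"
      "joubert A 1 + joubert A 5 + joubert A 6 \<noteq> 0" "joubert A 1 + joubert A 3 + joubert A 5 \<noteq> 0"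
      "joubert A 1 + joubert A 2 + joubert A 3 \<noteq> 0" "joubert A 2 + joubert A 3 + joubert A 5 \<noteq> 0"
      "joubert A 1 + joubert A 2 + joubert A 5 \<noteq> 0" "joubert A 1 + joubert A 4 + joubert A 5 \<noteq> 0"
    by simp_all
  note B = J[unfolded joubert_triple_nonzero_iff[OF three]]
  have swap: "bracket A j i k \<noteq> 0" if "bracket A i j k \<noteq> 0" for i j k
    using that bracket_swap[of A j i k] by simp
  have rotate: "bracket A j k i \<noteq> 0" if "bracket A i j k \<noteq> 0" for i j k
    using that by (simp only: bracket_rotate[of A j k i] not_False_eq_True)
  show "generic_arrangement A"
    unfolding generic_arrangement_iff
  proof (intro allI impI)
    fix i j k :: 6
    assume d: "i \<noteq> j" "j \<noteq> k" "i \<noteq> k"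
    show "bracket A i j k \<noteq> 0"
      by (rule triples_6[where Q = "\<lambda>i j k. bracket A i j k \<noteq> 0", OF d swap rotate B(1)[THEN conjunct1]
          B(2)[THEN conjunct1] B(3)[THEN conjunct1] B(4)[THEN conjunct1] B(5)[THEN conjunct1] B(6)[THEN
          conjunct1] B(7)[THEN conjunct1] B(8)[THEN conjunct1] B(9)[THEN conjunct1] B(10)[THEN conjunct1]
          B(10)[THEN conjunct2] B(9)[THEN conjunct2] B(8)[THEN conjunct2] B(7)[THEN conjunct2] B(6)[THEN
          conjunct2] B(5)[THEN conjunct2] B(4)[THEN conjunct2] B(3)[THEN conjunct2] B(2)[THEN conjunct2]
          B(1)[THEN conjunct2]])
  qed
qed

lemma transpose_eq_iff:
  assumes "i \<noteq> j" "Transposition.transpose i j = Transposition.transpose k l"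
  shows "k = i \<and> l = j \<or> k = j \<and> l = i"
  using fun_cong[OF assms(2), of i] fun_cong[OF assms(2), of j] assms(1)
  by (auto simp: Transposition.transpose_def split: if_splits)

text \<open>Injectivity of \<open>\<phi>\<close> recovers the pair {i, j} from the permutation, so
  the criterion obtained for some pair is the one for the given pair.\<close>

lemma non_very_generic_perms_eq:
  fixes A :: "'a::field^3^6"
  assumes gen: "generic_arrangement A" and three: "(3::'a) \<noteq> 0" and phi: "is_phi \<phi>"
  shows "non_very_generic_perms A = {\<phi> (transp i j) | i j. i \<noteq> j \<and> joubert A i = joubert A j}"
proof (intro subset_antisym subsetI)
  fix \<sigma>
  assume "\<sigma> \<in> non_very_generic_perms A"
  then obtain T where "corresponds \<sigma> T" "non_very_generic A T"
    by (auto simp: non_very_generic_perms_def)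
  then show "\<sigma> \<in> {\<phi> (transp i j) | i j. i \<noteq> j \<and> joubert A i = joubert A j}"
    using non_very_generic_iff_joubert[OF gen three phi] by blast
next
  fix \<sigma>
  assume "\<sigma> \<in> {\<phi> (transp i j) | i j. i \<noteq> j \<and> joubert A i = joubert A j}"
  then obtain i j where ij: "\<sigma> = \<phi> (transp i j)" "i \<noteq> j" "joubert A i = joubert A j"
    by blast
  then obtain T where T: "corresponds \<sigma> T"
    using corresponds_transp[OF phi] by blast
  then obtain k l where kl: "k \<noteq> l" "\<sigma> = \<phi> (transp k l)" "non_very_generic A T \<longleftrightarrow> joubert A k = joubert A l"
    using non_very_generic_iff_joubert[OF gen three phi] by blast
  have "transp i j = transp k l"
    using is_phi_inj[OF phi, of "transp i j" "transp k l"] ij(1) kl(2) by simp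
  with ij kl have "non_very_generic A T"
    using transpose_eq_iff by metis
  with T show "\<sigma> \<in> non_very_generic_perms A"
    by (auto simp: non_very_generic_perms_def)
qed

text \<open>Equality of edge sets becomes equality of relations on the indices: the blocks are the
  level sets of the Joubert invariants.\<close>

lemma has_type_iff_joubert:
  fixes A :: "'a::field^3^6"
  assumes gen: "generic_arrangement A" and three: "(3::'a) \<noteq> 0" and phi: "is_phi \<phi>"
  shows "has_type \<phi> A \<nu> \<longleftrightarrow>
    (\<exists>P. partition_on UNIV P \<and> partition_type P = \<nu> \<and>
      (\<forall>i j. (\<exists>B\<in>P. i \<in> B \<and> j \<in> B) \<longleftrightarrow> joubert A i = joubert A j))"
proof -
  have edges_iff: "subgraph_edges \<phi> P = non_very_generic_perms A \<longleftrightarrow>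
      (\<forall>i j. (\<exists>B\<in>P. i \<in> B \<and> j \<in> B) \<longleftrightarrow> joubert A i = joubert A j)" if "partition_on UNIV P" for P
  proof -
    \<comment> \<open>Inclusion of edge sets is implication between relations. Symmetry of
      \<open>g\<close> is required because an edge may be matched with its reversed pair.\<close>
    have edges: "{\<phi> (transp i j) | i j. i \<noteq> j \<and> f i j} \<subseteq> {\<phi> (transp i j) | i j. i \<noteq> j \<and> g i j} \<longleftrightarrow>
       (\<forall>i j. i \<noteq> j \<longrightarrow> f i j \<longrightarrow> g i j)" if "\<And>i j. g i j \<Longrightarrow> g j i" for f g :: "6 \<Rightarrow> 6 \<Rightarrow> bool"
    proof (intro iffI allI impI)
      fix i j
      assume sub: "{\<phi> (transp i j) | i j. i \<noteq> j \<and> f i j} \<subseteq> {\<phi> (transp i j) | i j. i \<noteq> j \<and> g i j}"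
        and "i \<noteq> j" "f i j"
      then obtain k l where "k \<noteq> l" "g k l" "\<phi> (transp i j) = \<phi> (transp k l)"
        by blast
      moreover from this(3) have "transp i j = transp k l"
        using is_phi_inj[OF phi, of "transp i j" "transp k l"] by simp
      ultimately show "g i j"
        using \<open>i \<noteq> j\<close> that transpose_eq_iff by metis
    next
      assume *: "\<forall>i j. i \<noteq> j \<longrightarrow> f i j \<longrightarrow> g i j"
      show "{\<phi> (transp i j) | i j. i \<noteq> j \<and> f i j} \<subseteq> {\<phi> (transp i j) | i j. i \<noteq> j \<and> g i j}"
      proof
        fix \<sigma>
        assume "\<sigma> \<in> {\<phi> (transp i j) | i j. i \<noteq> j \<and> f i j}"
        then obtain i j where "\<sigma> = \<phi> (transp i j)" "i \<noteq> j" "f i j" by auto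
        with * show "\<sigma> \<in> {\<phi> (transp i j) | i j. i \<noteq> j \<and> g i j}" by auto
      qed
    qed
    \<comment> \<open>Edges only see pairs of distinct indices; on the diagonal both relations
      hold.\<close>
    have off_diagonal: "(\<forall>i j. i \<noteq> j \<longrightarrow> L i j \<longrightarrow> c i = c j) \<and> (\<forall>i j. i \<noteq> j \<longrightarrow> c i = c j \<longrightarrow> L i j)
      \<longleftrightarrow> (\<forall>i j. L i j \<longleftrightarrow> c i = c j)" if "\<And>i. L i i" for L :: "6 \<Rightarrow> 6 \<Rightarrow> bool" and c :: "6 \<Rightarrow> 'a"
    proof
      assume *: "(\<forall>i j. i \<noteq> j \<longrightarrow> L i j \<longrightarrow> c i = c j) \<and> (\<forall>i j. i \<noteq> j \<longrightarrow> c i = c j \<longrightarrow> L i j)"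
      have "L i j \<longleftrightarrow> c i = c j" for i j
      proof (cases "i = j")
        case True
        with that show ?thesis by simp
      next
        case False
        with * show ?thesis by blast
      qed
      then show "\<forall>i j. L i j \<longleftrightarrow> c i = c j" by blast
    next
      assume "\<forall>i j. L i j \<longleftrightarrow> c i = c j"
      then show "(\<forall>i j. i \<noteq> j \<longrightarrow> L i j \<longrightarrow> c i = c j) \<and> (\<forall>i j. i \<noteq> j \<longrightarrow> c i = c j \<longrightarrow> L i j)"
        by blast
    qed
    have diagonal: "\<exists>B\<in>P. i \<in> B \<and> i \<in> B" for i
      using \<open>partition_on UNIV P\<close> by (auto simp: partition_on_def)
    let ?f = "\<lambda>i j. \<exists>B\<in>P. i \<in> B \<and> j \<in> B" and ?g = "\<lambda>i j. joubert A i = joubert A j"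
    have sub: "subgraph_edges \<phi> P \<subseteq> non_very_generic_perms A \<longleftrightarrow> (\<forall>i j. i \<noteq> j \<longrightarrow> ?f i j \<longrightarrow> ?g i j)"
      unfolding non_very_generic_perms_eq[OF gen three phi] subgraph_edges_def
      by (rule edges[where f = ?f and g = ?g]) (rule sym)
    have sup: "non_very_generic_perms A \<subseteq> subgraph_edges \<phi> P \<longleftrightarrow> (\<forall>i j. i \<noteq> j \<longrightarrow> ?g i j \<longrightarrow> ?f i j)"
      unfolding non_very_generic_perms_eq[OF gen three phi] subgraph_edges_def
      by (rule edges[where f = ?g and g = ?f]) blast
    show ?thesis
      unfolding set_eq_subset sub sup by (rule off_diagonal[where L = ?f, OF diagonal])
  qed
  show ?thesis
    unfolding has_type_def by (simp only: edges_iff cong: conj_cong)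
qed

lemma numeral_neq_0_CHAR: "CHAR('a) = 0 \<Longrightarrow> (numeral n :: 'a::field) \<noteq> 0"
  using of_nat_eq_0_iff_char_dvd[of "numeral n", where 'a = 'a] by simp

section \<open>Partitions with prescribed block sizes\<close>

text \<open>Eliminating repeatedly with this rule turns a concrete type into an explicit list of
  distinct blocks.\<close>

lemma partition_type_eq_add_msetE:
  assumes "partition_type P = add_mset n \<nu>"
  obtains B Q where "P = insert B Q" "B \<notin> Q" "card B = n" "partition_type Q = \<nu>"
proof -
  obtain B M where B: "mset_set P = add_mset B M" "card B = n" "image_mset card M = \<nu>"
    using assms msed_map_invR unfolding partition_type_def by metis
  have "B \<in># mset_set P"
    using B(1) by simp
  then have "B \<in> P"
    by (simp add: elem_mset_set)
  moreover from this have "M = mset_set (P - {B})"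
    using B(1) mset_set.remove[of P B] by simp
  ultimately show thesis
    using B that[of B "P - {B}"] by (auto simp: partition_type_def)
qed

lemma partition_type_eq_empty_iff: "partition_type P = {#} \<longleftrightarrow> P = {}"
  by (simp add: partition_type_def mset_set_empty_iff)

lemma partition_type_insert: "B \<notin> P \<Longrightarrow> partition_type (insert B P) = add_mset (card B) (partition_type P)"
  by (simp add: partition_type_def)

lemma constant_on_block:
  assumes "\<And>i j. (\<exists>B\<in>P. i \<in> B \<and> j \<in> B) \<longleftrightarrow> c i = c j" "B \<in> P"
  obtains x where "\<And>i. i \<in> B \<Longrightarrow> c i = x"
proof (cases "B = {}")
  case False
  then obtain j where "j \<in> B" by auto
  then have "c i = c j" if "i \<in> B" for i
    using assms that by metis
  then show thesis by (rule that)
qed (use that in auto)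

lemma card_3_subset:
  assumes "3 \<le> card B"
  obtains i j k where "i \<in> B" "j \<in> B" "k \<in> B" "i \<noteq> j" "j \<noteq> k" "i \<noteq> k"
proof -
  obtain S where "S \<subseteq> B" "card S = 3"
    using assms by (metis obtain_subset_with_card_n)
  then show thesis
    using that unfolding card_3_iff by blast
qed

text \<open>Exponent 1 relates the two values through the vanishing sum of the invariants; exponents
  2 and 4 enter the quartic expression.\<close>

lemma two_block_power_sums:
  fixes c :: "6 \<Rightarrow> 'a::field"
  assumes P: "partition_on UNIV P" "partition_type P = {#a, b#}"
    and c: "\<And>i j. (\<exists>B\<in>P. i \<in> B \<and> j \<in> B) \<longleftrightarrow> c i = c j"
  obtains B C x y where "card B = a" "card C = b" "B \<inter> C = {}"
    "\<And>i. i \<in> B \<Longrightarrow> c i = x" "\<And>i. i \<in> C \<Longrightarrow> c i = y"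
    "\<And>n. (\<Sum>i\<in>UNIV. c i ^ n) = of_nat a * x ^ n + of_nat b * y ^ n"
proof -
  obtain B C where BC: "P = {B, C}" "B \<noteq> C" "card B = a" "card C = b"
    using P(2) by (elim partition_type_eq_add_msetE) (auto simp: partition_type_eq_empty_iff)
  obtain x where x: "\<And>i. i \<in> B \<Longrightarrow> c i = x"
    using constant_on_block[OF c, of B] BC(1) by blast
  obtain y where y: "\<And>i. i \<in> C \<Longrightarrow> c i = y"
    using constant_on_block[OF c, of C] BC(1) by blast
  have dis: "B \<inter> C = {}" "B \<union> C = UNIV"
    using P(1) BC(1,2) by (auto simp: partition_on_def disjoint_def)
  have "(\<Sum>i\<in>UNIV. c i ^ n) = of_nat a * x ^ n + of_nat b * y ^ n" for n
  proof -
    have "(\<Sum>i\<in>UNIV. c i ^ n) = (\<Sum>i\<in>B. c i ^ n) + (\<Sum>i\<in>C. c i ^ n)"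
      unfolding dis(2)[symmetric] by (rule sum.union_disjoint) (simp_all add: dis)
    also have "\<dots> = (\<Sum>i\<in>B. x ^ n) + (\<Sum>i\<in>C. y ^ n)"
      by (simp add: x y)
    finally show ?thesis by (simp add: BC)
  qed
  with BC dis x y show thesis using that by blast
qed

section \<open>Obstructions to particular types\<close>

context
  fixes A :: "'a::field^3^6" and \<phi>
  assumes char_0: "CHAR('a) = 0" and generic: "generic_arrangement A" and phi: "is_phi \<phi>"
begin

private lemma num: "(numeral n :: 'a) \<noteq> 0"
  using char_0 by (rule numeral_neq_0_CHAR)

private lemma triple: "i \<noteq> j \<Longrightarrow> j \<noteq> k \<Longrightarrow> i \<noteq> k \<Longrightarrow> joubert A i + joubert A j + joubert A k \<noteq> 0"
  using generic generic_arrangement_iff_joubert[of A] num by blast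

private lemma typeE:
  assumes "has_type \<phi> A \<nu>"
  obtains P where "partition_on UNIV P" "partition_type P = \<nu>"
    "\<And>i j. (\<exists>B\<in>P. i \<in> B \<and> j \<in> B) \<longleftrightarrow> joubert A i = joubert A j"
  using assms has_type_iff_joubert[OF generic num phi] by auto

private lemma quartic: "\<exists>w. 4 * (\<Sum>i\<in>UNIV. joubert A i ^ 4) - (\<Sum>i\<in>UNIV. joubert A i ^ 2) ^ 2 = w ^ 2"
  using generic by (intro joubert_quartic) (simp add: generic_arrangement_iff)

text \<open>Three indices of the block have sum \<open>x + x + x\<close>, which genericity forbids
  to vanish.\<close>

private lemma block_value_nonzero:
  assumes "3 \<le> card B" "\<And>i. i \<in> B \<Longrightarrow> joubert A i = x"
  shows "x \<noteq> 0"
proof -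
  obtain i j k where "i \<in> B" "j \<in> B" "k \<in> B" "i \<noteq> j" "j \<noteq> k" "i \<noteq> k"
    using assms(1) by (rule card_3_subset)
  then have "x + x + x \<noteq> 0"
    using triple[of i j k] assms(2) by simp
  then show ?thesis by auto
qed

lemma has_type_1_5_imp_sqrt_5:
  assumes "has_type \<phi> A {#1, 5#}"
  shows "\<exists>s :: 'a. s ^ 2 = 5"
proof -
  obtain P where P: "partition_on UNIV P" "partition_type P = {#1, 5#}"
    "\<And>i j. (\<exists>B\<in>P. i \<in> B \<and> j \<in> B) \<longleftrightarrow> joubert A i = joubert A j"
    by (rule typeE[OF assms]) (rule that)
  obtain B C x y where BC: "card C = 5" "\<And>i. i \<in> C \<Longrightarrow> joubert A i = y"
    and sums: "\<And>n. (\<Sum>i\<in>UNIV. joubert A i ^ n) = of_nat 1 * x ^ n + of_nat 5 * y ^ n"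
    by (rule two_block_power_sums[OF P]) (rule that)
  have "y \<noteq> 0"
    using block_value_nonzero[of C y] BC by simp
  have "x + 5 * y = 0"
    using sums[of 1] sum_UNIV_joubert[of A] by simp
  then have x: "x = - 5 * y"
    by (simp add: eq_neg_iff_add_eq_0)
  obtain w where w: "4 * (\<Sum>i\<in>UNIV. joubert A i ^ 4) - (\<Sum>i\<in>UNIV. joubert A i ^ 2) ^ 2 = w ^ 2"
    using quartic by blast
  \<comment> \<open>With x = -5y the coefficient is 4(625 + 5) - (25 + 5)^2 = 1620 = 5 *
    18^2.\<close>
  have "w ^ 2 = 5 * (18 * y ^ 2) ^ 2"
    unfolding w[symmetric] sums x by (simp add: power2_eq_square power4_eq_xxxx algebra_simps)
  then have "(w / (18 * y ^ 2)) ^ 2 = 5"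
    using \<open>y \<noteq> 0\<close> by (simp add: power_divide num)
  then show ?thesis by blast
qed

lemma has_type_3_3_imp_sqrt_minus_3:
  assumes "has_type \<phi> A {#3, 3#}"
  shows "\<exists>s :: 'a. s ^ 2 = - 3"
proof -
  obtain P where P: "partition_on UNIV P" "partition_type P = {#3, 3#}"
    "\<And>i j. (\<exists>B\<in>P. i \<in> B \<and> j \<in> B) \<longleftrightarrow> joubert A i = joubert A j"
    by (rule typeE[OF assms]) (rule that)
  obtain B C x y where BC: "card C = 3" "\<And>i. i \<in> C \<Longrightarrow> joubert A i = y"
    and sums: "\<And>n. (\<Sum>i\<in>UNIV. joubert A i ^ n) = of_nat 3 * x ^ n + of_nat 3 * y ^ n"
    by (rule two_block_power_sums[OF P]) (rule that)
  have "y \<noteq> 0"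
    using block_value_nonzero[of C y] BC by simp
  have "3 * (x + y) = 0"
    using sums[of 1] sum_UNIV_joubert[of A] by (simp add: distrib_left)
  then have x: "x = - y"
    by (simp only: mult_eq_0_iff num simp_thms eq_neg_iff_add_eq_0)
  obtain w where w: "4 * (\<Sum>i\<in>UNIV. joubert A i ^ 4) - (\<Sum>i\<in>UNIV. joubert A i ^ 2) ^ 2 = w ^ 2"
    using quartic by blast
  \<comment> \<open>With x = -y the coefficient is 4 * 6 - 6^2 = -12 = -3 * 2^2.\<close>
  have "w ^ 2 = - 3 * (2 * y ^ 2) ^ 2"
    unfolding w[symmetric] sums x by (simp add: power2_eq_square power4_eq_xxxx algebra_simps)
  then have "(w / (2 * y ^ 2)) ^ 2 = - 3"
    using \<open>y \<noteq> 0\<close> by (simp add: power_divide num)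
  then show ?thesis by blast
qed

text \<open>Half of the vanishing total is \<open>x + y + y\<close>, the sum over one index of the
  pair and two of the other block.\<close>

lemma not_has_type_2_4: "\<not> has_type \<phi> A {#2, 4#}"
proof
  assume "has_type \<phi> A {#2, 4#}"
  then obtain P where P: "partition_on UNIV P" "partition_type P = {#2, 4#}"
    "\<And>i j. (\<exists>B\<in>P. i \<in> B \<and> j \<in> B) \<longleftrightarrow> joubert A i = joubert A j"
    using typeE by blast
  obtain B C x y where BC: "card B = 2" "card C = 4" "B \<inter> C = {}"
      "\<And>i. i \<in> B \<Longrightarrow> joubert A i = x" "\<And>i. i \<in> C \<Longrightarrow> joubert A i = y"
    and sums: "\<And>n. (\<Sum>i\<in>UNIV. joubert A i ^ n) = of_nat 2 * x ^ n + of_nat 4 * y ^ n"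
    by (rule two_block_power_sums[OF P]) (rule that)
  have "2 * (x + y + y) = 0"
    using sums[of 1] sum_UNIV_joubert[of A] by (simp add: algebra_simps)
  then have 0: "x + y + y = 0"
    by (simp only: mult_eq_0_iff num simp_thms)
  obtain i where i: "i \<in> B"
    using BC(1) by fastforce
  obtain j k l where jk: "j \<in> C" "k \<in> C" "l \<in> C" "j \<noteq> k" "k \<noteq> l" "j \<noteq> l"
    using card_3_subset[of C] BC(2) by auto
  have "i \<noteq> j" "i \<noteq> k"
    using i jk BC(3) by auto
  then show False
    using triple[of i j k] i jk BC(4,5) 0 by simp
qed

text \<open>Half of the vanishing total is the sum over one index from each block.\<close>

lemma not_has_type_2_2_2: "\<not> has_type \<phi> A {#2, 2, 2#}"
proof
  assume "has_type \<phi> A {#2, 2, 2#}"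
  then obtain P where P: "partition_on UNIV P" "partition_type P = {#2, 2, 2#}"
    and c: "\<And>i j. (\<exists>B\<in>P. i \<in> B \<and> j \<in> B) \<longleftrightarrow> joubert A i = joubert A j"
    using typeE by blast
  obtain B C D where BCD: "P = {B, C, D}" "B \<noteq> C" "B \<noteq> D" "C \<noteq> D" "card B = 2" "card C = 2" "card D = 2"
    using P(2) by (elim partition_type_eq_add_msetE) (auto simp: partition_type_eq_empty_iff)
  obtain x where x: "\<And>i. i \<in> B \<Longrightarrow> joubert A i = x"
    using constant_on_block[OF c, of B] BCD(1) by blast
  obtain y where y: "\<And>i. i \<in> C \<Longrightarrow> joubert A i = y"
    using constant_on_block[OF c, of C] BCD(1) by blast
  obtain z where z: "\<And>i. i \<in> D \<Longrightarrow> joubert A i = z"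
    using constant_on_block[OF c, of D] BCD(1) by blast
  have dis: "B \<inter> C = {}" "B \<inter> D = {}" "C \<inter> D = {}" "B \<union> (C \<union> D) = UNIV"
    using P(1) BCD(1-4) by (auto simp: partition_on_def disjoint_def)
  have "0 = (\<Sum>i\<in>B \<union> (C \<union> D). joubert A i)"
    unfolding dis(4) by (simp add: sum_UNIV_joubert)
  also have "\<dots> = (\<Sum>i\<in>B. joubert A i) + ((\<Sum>i\<in>C. joubert A i) + (\<Sum>i\<in>D. joubert A i))"
    using dis(1-3) by (simp add: sum.union_disjoint Int_Un_distrib)
  also have "\<dots> = 2 * (x + y + z)"
    by (simp add: x y z BCD algebra_simps)
  finally have "2 * (x + y + z) = 0"
    by (rule sym)
  then have 0: "x + y + z = 0"
    by (simp only: mult_eq_0_iff num simp_thms)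
  obtain i j k where "i \<in> B" "j \<in> C" "k \<in> D"
    using BCD(5-7) by (metis card.empty equals0I zero_neq_numeral)
  moreover from this have "i \<noteq> j" "j \<noteq> k" "i \<noteq> k"
    using dis by auto
  ultimately show False
    using triple[of i j k] x y z 0 by simp
qed

text \<open>Six equal invariants with sum 0 are all 0, and so are their triple sums.\<close>

lemma not_has_type_6: "\<not> has_type \<phi> A {#6#}"
proof
  assume "has_type \<phi> A {#6#}"
  then obtain P where P: "partition_on UNIV P" "partition_type P = {#6#}"
    and c: "\<And>i j. (\<exists>B\<in>P. i \<in> B \<and> j \<in> B) \<longleftrightarrow> joubert A i = joubert A j"
    using typeE by blast
  obtain B where B: "P = {B}"
    using P(2) by (elim partition_type_eq_add_msetE) (auto simp: partition_type_eq_empty_iff)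
  then have "UNIV \<in> P"
    using P(1) by (simp add: partition_on_def)
  then obtain x where x: "\<And>i. i \<in> UNIV \<Longrightarrow> joubert A i = x"
    by (rule constant_on_block[OF c]) (rule that)
  have "6 * x = 0"
    using sum_UNIV_joubert[of A] by (simp add: x)
  then have "x = 0"
    by (simp only: mult_eq_0_iff num simp_thms)
  moreover have "x \<noteq> 0"
    by (rule block_value_nonzero[of UNIV]) (simp_all add: x)
  ultimately show False by simp
qed

end

section \<open>Existence\<close>

text \<open>Normal form under change of coordinates and rescaling of the forms: the first four rows
  are the standard projective frame, and only rows 5 and 6 vary.\<close>

definition frame_matrix :: "'a \<Rightarrow> 'a \<Rightarrow> 'a \<Rightarrow> 'a \<Rightarrow> 'a \<Rightarrow> 'a \<Rightarrow> 'a::field^3^6" where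
  "frame_matrix a b c d e f =
    (\<chi> i. if i = 1 then vector [1, 0, 0] else if i = 2 then vector [0, 1, 0] else if i = 3 then vector [0, 0, 1]
         else if i = 4 then vector [1, 1, 1] else if i = 5 then vector [a, b, c] else vector [d, e, f])"

definition six :: "'a \<Rightarrow> 'a \<Rightarrow> 'a \<Rightarrow> 'a \<Rightarrow> 'a \<Rightarrow> 'a \<Rightarrow> 6 \<Rightarrow> 'a" where
  "six a b c d e f i = (if i = 1 then a else if i = 2 then b else if i = 3 then c else if i = 4 then d else if i
      = 5 then e else f)"

lemma six_simps [simp]:
  "six a b c d e f 1 = a" "six a b c d e f 2 = b" "six a b c d e f 3 = c"
  "six a b c d e f 4 = d" "six a b c d e f 5 = e" "six a b c d e f 6 = f"
  by (simp_all add: six_def)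

text \<open>The formulas of \<open>joubert_frame\<close> evaluated on \<open>frame_matrix\<close>,
  where \<open>D\<close> is 1. Being polynomial, they make sense over the integers too.\<close>

definition frame_joubert :: "'a \<Rightarrow> 'a \<Rightarrow> 'a \<Rightarrow> 'a \<Rightarrow> 'a \<Rightarrow> 'a \<Rightarrow> 6 \<Rightarrow> 'a::comm_ring_1" where
  "frame_joubert a b c d e f =
    (let E = b * f + c * d + a * e; F = c * e + b * d + a * f in
     six (F - 2 * E + 3 * (b * f)) (F - 2 * E + 3 * (c * d)) (E - 2 * F + 3 * (c * e))
         (E - 2 * F + 3 * (b * d)) (E - 2 * F + 3 * (a * f)) (F - 2 * E + 3 * (a * e)))"

lemma joubert_frame_matrix: "joubert (frame_matrix a b c d e f) i = frame_joubert a b c d e f i"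
proof -
  let ?M = "frame_matrix a b c d e f"
  have "bracket ?M 1 2 3 = 1" "bracket ?M 2 3 4 = 1" "bracket ?M 1 3 4 = - 1" "bracket ?M 1 2 4 = 1"
    "bracket ?M 2 3 5 = a" "bracket ?M 1 3 5 = - b" "bracket ?M 1 2 5 = c"
    "bracket ?M 2 3 6 = d" "bracket ?M 1 3 6 = - e" "bracket ?M 1 2 6 = f"
    by (simp_all add: bracket_def frame_matrix_def)
  note J = joubert_frame[of ?M, unfolded this]
  define E F where "E = b * f + c * d + a * e" and "F = c * e + b * d + a * f"
  have J: "joubert ?M 1 = F - 2 * E + 3 * (b * f)" "joubert ?M 2 = F - 2 * E + 3 * (c * d)"
    "joubert ?M 6 = F - 2 * E + 3 * (a * e)" "joubert ?M 3 = E - 2 * F + 3 * (c * e)"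
    "joubert ?M 4 = E - 2 * F + 3 * (b * d)" "joubert ?M 5 = E - 2 * F + 3 * (a * f)"
    using J by (simp_all add: E_def F_def)
  have "\<forall>i. joubert ?M i = frame_joubert a b c d e f i"
    unfolding forall_6 J by (simp add: frame_joubert_def Let_def E_def F_def)
  then show ?thesis by blast
qed

lemma frame_joubert_of_int:
  "frame_joubert (of_int a) (of_int b) (of_int c) (of_int d) (of_int e) (of_int f) i
      = of_int (frame_joubert a b c d e f i)"
  by (simp add: frame_joubert_def Let_def six_def)

definition kernel_partition :: "6 set set \<Rightarrow> (6 \<Rightarrow> 'a) \<Rightarrow> bool" where
  "kernel_partition P c \<longleftrightarrow> partition_on UNIV P \<and> (\<forall>i j. (\<exists>B\<in>P. i \<in> B \<and> j \<in> B) \<longleftrightarrow> c i = c j)"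

lemma exists_type_of_frame:
  fixes a b c d e f :: "'a::field"
  assumes char_0: "CHAR('a) = 0" and phi: "is_phi \<phi>"
    and ker: "kernel_partition P (frame_joubert a b c d e f)" and type: "partition_type P = \<nu>"
    and triple: "\<And>i j k. i \<noteq> j \<Longrightarrow> j \<noteq> k \<Longrightarrow> i \<noteq> k \<Longrightarrow>
      frame_joubert a b c d e f i + frame_joubert a b c d e f j + frame_joubert a b c d e f k \<noteq> 0"
  shows "\<exists>A :: 'a^3^6. generic_arrangement A \<and> has_type \<phi> A \<nu>"
proof -
  let ?A = "frame_matrix a b c d e f"
  have gen: "generic_arrangement ?A"
    using triple by (simp add: generic_arrangement_iff_joubert numeral_neq_0_CHAR[OF char_0]
        joubert_frame_matrix)
  moreover have "has_type \<phi> ?A \<nu>"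
    unfolding has_type_iff_joubert[OF gen numeral_neq_0_CHAR[OF char_0] phi] joubert_frame_matrix
    using ker type by (intro exI[of _ P]) (simp add: kernel_partition_def)
  ultimately show ?thesis by blast
qed

text \<open>In characteristic 0 the map \<open>of_int\<close> is injective, so coincidences and
  nonvanishing checked over the integers hold over every such field.\<close>

lemma exists_type_of_integer_frame:
  fixes a b c d e f :: int
  assumes char_0: "CHAR('a::field) = 0" and phi: "is_phi \<phi>"
    and ker: "kernel_partition P (frame_joubert a b c d e f)" and type: "partition_type P = \<nu>"
    and triple: "\<And>i j k. i \<noteq> j \<Longrightarrow> j \<noteq> k \<Longrightarrow> i \<noteq> k \<Longrightarrow>
      frame_joubert a b c d e f i + frame_joubert a b c d e f j + frame_joubert a b c d e f k \<noteq> 0"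
  shows "\<exists>A :: 'a^3^6. generic_arrangement A \<and> has_type \<phi> A \<nu>"
proof -
  have zero: "(of_int m :: 'a) = 0 \<longleftrightarrow> m = 0" for m
    using char_0 by (simp add: of_int_eq_0_iff_char_dvd)
  have inject: "(of_int m :: 'a) = of_int n \<longleftrightarrow> m = n" for m n
    using zero[of "m - n"] by simp
  show ?thesis
  proof (rule exists_type_of_frame[OF char_0 phi _ type])
    show "kernel_partition P (frame_joubert (of_int a) (of_int b) (of_int c) (of_int d) (of_int e) (of_int f) ::
        6 \<Rightarrow> 'a)"
      using ker by (simp add: kernel_partition_def frame_joubert_of_int inject)
    show "frame_joubert (of_int a) (of_int b) (of_int c) (of_int d) (of_int e) (of_int f) i
      + frame_joubert (of_int a) (of_int b) (of_int c) (of_int d) (of_int e) (of_int f) j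
      + frame_joubert (of_int a) (of_int b) (of_int c) (of_int d) (of_int e) (of_int f) k \<noteq> (0 :: 'a)"
      if "i \<noteq> j" "j \<noteq> k" "i \<noteq> k" for i j k
      using triple[OF that] by (simp only: frame_joubert_of_int of_int_add[symmetric] zero not_False_eq_True)
  qed
qed

lemma partition_on_no_blocks_iff: "partition_on A {} \<longleftrightarrow> A = {}"
  by (auto simp: partition_on_def)

lemma exists_rational_types:
  fixes \<nu> :: "nat multiset"
  assumes char_0: "CHAR('k::field) = 0" and phi: "is_phi \<phi>"
    and \<nu>: "\<nu> \<in> {{#1,1,1,1,1,1#}, {#1,1,1,1,2#}, {#1,1,1,3#}, {#1,1,2,2#}, {#1,1,4#}, {#1,2,3#}}"
  shows "\<exists>A :: 'k^3^6. generic_arrangement A \<and> has_type \<phi> A \<nu>"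
proof -
  \<comment> \<open>Here and below the arguments are rows 5 and 6 of an example with small integer
    entries; the six values on the right show the coincidences demanded by the type.\<close>
  have c0: "frame_joubert (-3) (-2) 1 (-1) 3 1 = (six 20 23 (-7) (-10) (-25) (-1) :: 6 \<Rightarrow> int)"
    by (simp add: frame_joubert_def)
  have e0: "\<exists>A :: 'k^3^6. generic_arrangement A \<and> has_type \<phi> A {#1,1,1,1,1,1#}"
  proof (rule exists_type_of_integer_frame[OF char_0 phi])
    show "kernel_partition {{1}, {2}, {3}, {4}, {5}, {6}} (frame_joubert (-3) (-2) 1 (-1) 3 1 :: 6 \<Rightarrow> int)"
      unfolding c0 kernel_partition_def UNIV_6 forall_6
      by (simp add: partition_on_insert partition_on_no_blocks_iff Diff_subset_conv disjnt_def)
    show "partition_type {{1}, {2}, {3}, {4}, {5}, {6}} = {#1,1,1,1,1,1#}"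
      by (simp add: partition_type_insert partition_type_eq_empty_iff[THEN iffD2] set_eq_iff forall_6
          numeral_eq_Suc)
    show "frame_joubert (-3) (-2) 1 (-1) 3 1 i + frame_joubert (-3) (-2) 1 (-1) 3 1 j
        + frame_joubert (-3) (-2) 1 (-1) 3 1 k \<noteq> (0::int)"
      if "i \<noteq> j" "j \<noteq> k" "i \<noteq> k" for i j k
      unfolding c0
      by (rule triples_6[where Q = "\<lambda>i j k. six 20 23 (-7) (-10) (-25) (-1) i
          + six 20 23 (-7) (-10) (-25) (-1) j + six 20 23 (-7) (-10) (-25) (-1) k \<noteq> (0::int)", OF that])
         simp_all
  qed
  have c1: "frame_joubert (-2) (-1) 1 (-1) 2 1 = (six 10 10 (-2) (-5) (-14) 1 :: 6 \<Rightarrow> int)"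
    by (simp add: frame_joubert_def)
  have e1: "\<exists>A :: 'k^3^6. generic_arrangement A \<and> has_type \<phi> A {#1,1,1,1,2#}"
  proof (rule exists_type_of_integer_frame[OF char_0 phi])
    show "kernel_partition {{3}, {4}, {5}, {6}, {1, 2}} (frame_joubert (-2) (-1) 1 (-1) 2 1 :: 6 \<Rightarrow> int)"
      unfolding c1 kernel_partition_def UNIV_6 forall_6
      by (simp add: partition_on_insert partition_on_no_blocks_iff Diff_subset_conv disjnt_def)
    show "partition_type {{3}, {4}, {5}, {6}, {1, 2}} = {#1,1,1,1,2#}"
      by (simp add: partition_type_insert partition_type_eq_empty_iff[THEN iffD2] set_eq_iff forall_6
          numeral_eq_Suc)
    show "frame_joubert (-2) (-1) 1 (-1) 2 1 i + frame_joubert (-2) (-1) 1 (-1) 2 1 j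
        + frame_joubert (-2) (-1) 1 (-1) 2 1 k \<noteq> (0::int)"
      if "i \<noteq> j" "j \<noteq> k" "i \<noteq> k" for i j k
      unfolding c1
      by (rule triples_6[where Q = "\<lambda>i j k. six 10 10 (-2) (-5) (-14) 1 i + six 10 10 (-2) (-5) (-14) 1 j
          + six 10 10 (-2) (-5) (-14) 1 k \<noteq> (0::int)", OF that])
         simp_all
  qed
  have c2: "frame_joubert (-2) (-1) 1 2 (-2) 1 = (six (-19) (-10) 11 11 11 (-4) :: 6 \<Rightarrow> int)"
    by (simp add: frame_joubert_def)
  have e2: "\<exists>A :: 'k^3^6. generic_arrangement A \<and> has_type \<phi> A {#1,1,1,3#}"
  proof (rule exists_type_of_integer_frame[OF char_0 phi])
    show "kernel_partition {{1}, {2}, {6}, {3, 4, 5}} (frame_joubert (-2) (-1) 1 2 (-2) 1 :: 6 \<Rightarrow> int)"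
      unfolding c2 kernel_partition_def UNIV_6 forall_6
      by (simp add: partition_on_insert partition_on_no_blocks_iff Diff_subset_conv disjnt_def)
    show "partition_type {{1}, {2}, {6}, {3, 4, 5}} = {#1,1,1,3#}"
      by (simp add: partition_type_insert partition_type_eq_empty_iff[THEN iffD2] set_eq_iff forall_6
          numeral_eq_Suc)
    show "frame_joubert (-2) (-1) 1 2 (-2) 1 i + frame_joubert (-2) (-1) 1 2 (-2) 1 j
        + frame_joubert (-2) (-1) 1 2 (-2) 1 k \<noteq> (0::int)"
      if "i \<noteq> j" "j \<noteq> k" "i \<noteq> k" for i j k
      unfolding c2
      by (rule triples_6[where Q = "\<lambda>i j k. six (-19) (-10) 11 11 11 (-4) i + six (-19) (-10) 11 11 11 (-4) j
          + six (-19) (-10) 11 11 11 (-4) k \<noteq> (0::int)", OF that])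
         simp_all
  qed
  have c3: "frame_joubert (-2) (-1) 1 (-1) (-2) 1 = (six (-10) (-10) 2 11 2 5 :: 6 \<Rightarrow> int)"
    by (simp add: frame_joubert_def)
  have e3: "\<exists>A :: 'k^3^6. generic_arrangement A \<and> has_type \<phi> A {#1,1,2,2#}"
  proof (rule exists_type_of_integer_frame[OF char_0 phi])
    show "kernel_partition {{4}, {6}, {1, 2}, {3, 5}} (frame_joubert (-2) (-1) 1 (-1) (-2) 1 :: 6 \<Rightarrow> int)"
      unfolding c3 kernel_partition_def UNIV_6 forall_6
      by (simp add: partition_on_insert partition_on_no_blocks_iff Diff_subset_conv disjnt_def)
    show "partition_type {{4}, {6}, {1, 2}, {3, 5}} = {#1,1,2,2#}"
      by (simp add: partition_type_insert partition_type_eq_empty_iff[THEN iffD2] set_eq_iff forall_6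
          numeral_eq_Suc)
    show "frame_joubert (-2) (-1) 1 (-1) (-2) 1 i + frame_joubert (-2) (-1) 1 (-1) (-2) 1 j
        + frame_joubert (-2) (-1) 1 (-1) (-2) 1 k \<noteq> (0::int)"
      if "i \<noteq> j" "j \<noteq> k" "i \<noteq> k" for i j k
      unfolding c3
      by (rule triples_6[where Q = "\<lambda>i j k. six (-10) (-10) 2 11 2 5 i + six (-10) (-10) 2 11 2 5 j
          + six (-10) (-10) 2 11 2 5 k \<noteq> (0::int)", OF that])
         simp_all
  qed
  have c4: "frame_joubert (-1) 2 1 2 (-1) 1 = (six (-2) (-2) (-2) 13 (-2) (-5) :: 6 \<Rightarrow> int)"
    by (simp add: frame_joubert_def)
  have e4: "\<exists>A :: 'k^3^6. generic_arrangement A \<and> has_type \<phi> A {#1,1,4#}"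
  proof (rule exists_type_of_integer_frame[OF char_0 phi])
    show "kernel_partition {{4}, {6}, {1, 2, 3, 5}} (frame_joubert (-1) 2 1 2 (-1) 1 :: 6 \<Rightarrow> int)"
      unfolding c4 kernel_partition_def UNIV_6 forall_6
      by (simp add: partition_on_insert partition_on_no_blocks_iff Diff_subset_conv disjnt_def)
    show "partition_type {{4}, {6}, {1, 2, 3, 5}} = {#1,1,4#}"
      by (simp add: partition_type_insert partition_type_eq_empty_iff[THEN iffD2] set_eq_iff forall_6
          numeral_eq_Suc)
    show "frame_joubert (-1) 2 1 2 (-1) 1 i + frame_joubert (-1) 2 1 2 (-1) 1 j
        + frame_joubert (-1) 2 1 2 (-1) 1 k \<noteq> (0::int)"
      if "i \<noteq> j" "j \<noteq> k" "i \<noteq> k" for i j k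
      unfolding c4
      by (rule triples_6[where Q = "\<lambda>i j k. six (-2) (-2) (-2) 13 (-2) (-5) i
          + six (-2) (-2) (-2) 13 (-2) (-5) j + six (-2) (-2) (-2) 13 (-2) (-5) k \<noteq> (0::int)", OF that])
         simp_all
  qed
  have c5: "frame_joubert (-3) (-2) 1 (-2) (-1) 1 = (six (-4) (-4) (-4) 11 (-10) 11 :: 6 \<Rightarrow> int)"
    by (simp add: frame_joubert_def)
  have e5: "\<exists>A :: 'k^3^6. generic_arrangement A \<and> has_type \<phi> A {#1,2,3#}"
  proof (rule exists_type_of_integer_frame[OF char_0 phi])
    show "kernel_partition {{5}, {4, 6}, {1, 2, 3}} (frame_joubert (-3) (-2) 1 (-2) (-1) 1 :: 6 \<Rightarrow> int)"
      unfolding c5 kernel_partition_def UNIV_6 forall_6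
      by (simp add: partition_on_insert partition_on_no_blocks_iff Diff_subset_conv disjnt_def)
    show "partition_type {{5}, {4, 6}, {1, 2, 3}} = {#1,2,3#}"
      by (simp add: partition_type_insert partition_type_eq_empty_iff[THEN iffD2] set_eq_iff forall_6
          numeral_eq_Suc)
    show "frame_joubert (-3) (-2) 1 (-2) (-1) 1 i + frame_joubert (-3) (-2) 1 (-2) (-1) 1 j
        + frame_joubert (-3) (-2) 1 (-2) (-1) 1 k \<noteq> (0::int)"
      if "i \<noteq> j" "j \<noteq> k" "i \<noteq> k" for i j k
      unfolding c5
      by (rule triples_6[where Q = "\<lambda>i j k. six (-4) (-4) (-4) 11 (-10) 11 i + six (-4) (-4) (-4) 11 (-10) 11 j
          + six (-4) (-4) (-4) 11 (-10) 11 k \<noteq> (0::int)", OF that])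
         simp_all
  qed
  show ?thesis
    using \<nu> e0 e1 e2 e3 e4 e5 by auto
qed

section \<open>Subfields of the complex field\<close>

text \<open>The subfield is modelled as \<open>range \<iota>\<close> for a field type
  \<open>'k\<close>, so that matrices over it are simply matrices over \<open>'k\<close>.\<close>

locale field_embedding =
  fixes \<iota> :: "'k::field \<Rightarrow> complex"
  assumes add: "\<iota> (x + y) = \<iota> x + \<iota> y" and mult: "\<iota> (x * y) = \<iota> x * \<iota> y" and one: "\<iota> 1 = 1"
begin

lemma zero: "\<iota> 0 = 0"
  using add[of 0 0] by simp

lemma uminus: "\<iota> (- x) = - \<iota> x"
  using add[of x "- x"] by (simp add: zero eq_neg_iff_add_eq_0 add.commute)

lemma eq_0_iff: "\<iota> x = 0 \<longleftrightarrow> x = 0"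
proof
  assume "\<iota> x = 0"
  show "x = 0"
  proof (rule ccontr)
    assume "x \<noteq> 0"
    then have "\<iota> x * \<iota> (inverse x) = 1"
      by (simp add: mult[symmetric] one)
    with \<open>\<iota> x = 0\<close> show False by simp
  qed
qed (simp add: zero)

lemma inverse: "\<iota> (inverse x) = inverse (\<iota> x)"
proof (cases "x = 0")
  case False
  then have "\<iota> x * \<iota> (inverse x) = 1"
    by (simp add: mult[symmetric] one)
  then show ?thesis
    by (metis inverse_unique)
qed (simp add: zero)

lemma of_nat: "\<iota> (of_nat n) = of_nat n"
  by (induction n) (simp_all add: zero add one)

lemma of_int: "\<iota> (of_int m) = of_int m"
  by (cases m) (simp_all add: of_nat uminus del: of_nat_Suc)

lemma CHAR_eq_0: "CHAR('k) = 0"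
  unfolding CHAR_eq0_iff using of_nat eq_0_iff by (metis of_nat_eq_0_iff less_numeral_extra(3))

lemma diff: "\<iota> (x - y) = \<iota> x - \<iota> y"
  using add[of x "- y"] by (simp add: uminus)

lemma inject: "\<iota> x = \<iota> y \<longleftrightarrow> x = y"
  using eq_0_iff[of "x - y"] by (simp add: diff)

lemma Rats_subset_range: "\<rat> \<subseteq> range \<iota>"
proof
  fix x :: complex
  assume "x \<in> \<rat>"
  then obtain a b where "x = of_int a / of_int b"
    by (cases x rule: Rats_cases') auto
  then have "x = \<iota> (of_int a * inverse (of_int b))"
    by (simp add: mult inverse of_int divide_inverse)
  then show "x \<in> range \<iota>" by simp
qed

lemma complex_adjoin_subset_range_iff: "complex_adjoin z \<subseteq> range \<iota> \<longleftrightarrow> z \<in> range \<iota>"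
proof
  show "complex_adjoin z \<subseteq> range \<iota> \<Longrightarrow> z \<in> range \<iota>"
    by (auto simp: complex_adjoin_def intro: generate_field.incl)
next
  assume z: "z \<in> range \<iota>"
  let ?C = "ring_of_type_algebra :: complex ring"
  interpret C: field ?C by (rule field_from_type_algebra)
  \<comment> \<open>\<open>generate_field\<close> uses the operations of an algebraic record;
    \<open>C\<close>, \<open>minus\<close> and \<open>inv\<close> translate them to those of the
    type class.\<close>
  have C: "carrier ?C = UNIV" "\<one>\<^bsub>?C\<^esub> = 1" "\<zero>\<^bsub>?C\<^esub> = 0" "x \<otimes>\<^bsub>?C\<^esub> y = x * y" "x \<oplus>\<^bsub>?C\<^esub> y = x + y" for x y
    by (simp_all add: ring_of_type_algebra_def)
  have minus: "\<ominus>\<^bsub>?C\<^esub> x = - x" for x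
    by (rule C.minus_equality) (simp_all add: C)
  have inv: "inv\<^bsub>?C\<^esub> x = inverse x" if "x \<noteq> 0" for x
    by (rule C.comm_inv_char) (simp_all add: C that)
  have closed: "1 \<in> range \<iota>" "- x \<in> range \<iota>" "inverse x \<in> range \<iota>" "x + y \<in> range \<iota>" "x * y \<in> range \<iota>"
    if "x \<in> range \<iota>" "y \<in> range \<iota>" for x y
  proof -
    obtain a b where "x = \<iota> a" "y = \<iota> b"
      using \<open>x \<in> range \<iota>\<close> \<open>y \<in> range \<iota>\<close> by blast
    then show "1 \<in> range \<iota>" "- x \<in> range \<iota>" "inverse x \<in> range \<iota>" "x + y \<in> range \<iota>" "x * y \<in> range \<iota>"
      by (simp_all flip: one uminus inverse add mult)
  qed
  show "complex_adjoin z \<subseteq> range \<iota>"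
  proof
    fix h
    assume "h \<in> complex_adjoin z"
    then show "h \<in> range \<iota>"
      unfolding complex_adjoin_def
      by (induction rule: generate_field.induct) (use z in \<open>simp_all add: C minus inv closed[OF z z] closed\<close>)
  qed
qed

text \<open>A square root in \<open>'k\<close> is mapped to plus or minus \<open>csqrt\<close>, and
  the range is closed under negation.\<close>

lemma complex_adjoin_csqrt_subset_range_iff:
  "complex_adjoin (csqrt (of_int m)) \<subseteq> range \<iota> \<longleftrightarrow> (\<exists>s :: 'k. s ^ 2 = of_int m)"
  unfolding complex_adjoin_subset_range_iff
proof
  assume "csqrt (of_int m) \<in> range \<iota>"
  then obtain s where s: "csqrt (of_int m) = \<iota> s" by blast
  have "\<iota> (s ^ 2) = (csqrt (of_int m)) ^ 2"
    by (simp only: s power2_eq_square mult)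
  also have "\<dots> = \<iota> (of_int m)"
    by (simp add: of_int)
  finally show "\<exists>s :: 'k. s ^ 2 = of_int m"
    unfolding inject by blast
next
  assume "\<exists>s :: 'k. s ^ 2 = of_int m"
  then obtain s :: 'k where "s ^ 2 = of_int m" by blast
  then have "\<iota> (s ^ 2) = of_int m"
    by (simp add: of_int)
  then have "(\<iota> s) ^ 2 = (csqrt (of_int m)) ^ 2"
    unfolding power2_csqrt by (simp add: power2_eq_square mult)
  then have "csqrt (of_int m) = \<iota> s \<or> csqrt (of_int m) = \<iota> (- s)"
    unfolding power2_eq_iff uminus by auto
  then show "csqrt (of_int m) \<in> range \<iota>" by blast
qed

end

lemma field_embedding_of_ring_hom:
  assumes "\<iota> \<in> ring_hom ring_of_type_algebra ring_of_type_algebra"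
  shows "field_embedding \<iota>"
  using assms by unfold_locales (simp_all add: ring_hom_def ring_of_type_algebra_def)

text \<open>
  With the golden ratio \<open>\<tau>\<close>, twice the rows \<open>(\<tau> - 1, \<tau>, 1)\<close> and \<open>(1, \<tau>, \<tau> - 1)\<close>.
\<close>

lemma exists_type_1_5:
  fixes s :: "'a::field"
  assumes char_0: "CHAR('a) = 0" and phi: "is_phi \<phi>" and s: "s ^ 2 = 5"
  shows "\<exists>A :: 'a^3^6. generic_arrangement A \<and> has_type \<phi> A {#1, 5#}"
proof (rule exists_type_of_frame[OF char_0 phi])
  note num = numeral_neq_0_CHAR[OF char_0]
  \<comment> \<open>The value shared by the five indices other than 5. In
    \<open>frame_joubert\<close> the three products in \<open>E\<close> are all 4, so E = 12, and F
    = 2s + 10.\<close>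
  define x where "x = 2 * s - 2"
  have s2: "s * s = 5"
    using s by (simp add: power2_eq_square)
  have c: "frame_joubert (s - 1) (s + 1) 2 2 (s + 1) (s - 1) = (\<lambda>i. if i = 5 then - 5 * x else x)" (is "?c = _")
  proof -
    have "\<forall>i. ?c i = (if i = 5 then - 5 * x else x)"
      unfolding forall_6 frame_joubert_def Let_def x_def by (simp add: algebra_simps s2)
    then show ?thesis by blast
  qed
  have x: "x \<noteq> 0"
  proof
    assume "x = 0"
    then have "2 * (s - 1) = 0"
      by (simp add: x_def algebra_simps)
    then have "s = 1"
      by (simp only: mult_eq_0_iff num simp_thms right_minus_eq)
    with s2 have "(5::'a) - 1 = 0" by simp
    then show False using num[of "num.Bit0 (num.Bit0 num.One)"] by simp
  qed
  have x': "x \<noteq> - 5 * x"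
  proof
    assume "x = - 5 * x"
    then have "6 * x = 0" by (simp add: algebra_simps)
    then show False
      by (simp only: mult_eq_0_iff num x simp_thms)
  qed
  then have x'': "- 5 * x \<noteq> x" by metis
  show "kernel_partition {{5}, {1, 2, 3, 4, 6}} ?c"
    unfolding kernel_partition_def UNIV_6 forall_6 c
    using x' x'' by (simp add: partition_on_insert partition_on_no_blocks_iff Diff_subset_conv disjnt_def)
  show "partition_type {{5}, {1, 2, 3, 4, 6}} = {#1, 5#}"
    by (simp add: partition_type_insert partition_type_eq_empty_iff[THEN iffD2] set_eq_iff forall_6
        numeral_eq_Suc)
  have 3: "x + x + x \<noteq> 0" "- 5 * x + x + x \<noteq> 0" "x + - 5 * x + x \<noteq> 0" "x + x + - 5 * x \<noteq> 0"
  proof -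
    have "3 * x \<noteq> 0"
      by (simp only: mult_eq_0_iff num x simp_thms)
    moreover have "x + x + x = 3 * x" "- 5 * x + x + x = - (3 * x)" "x + - 5 * x + x = - (3 * x)"
        "x + x + - 5 * x = - (3 * x)"
      by (simp_all add: algebra_simps)
    ultimately show "x + x + x \<noteq> 0" "- 5 * x + x + x \<noteq> 0" "x + - 5 * x + x \<noteq> 0" "x + x + - 5 * x \<noteq> 0"
      by (simp_all only: neg_equal_0_iff_equal simp_thms)
  qed
  show "?c i + ?c j + ?c k \<noteq> 0" if "i \<noteq> j" "j \<noteq> k" "i \<noteq> k" for i j k
    unfolding c using 3 that by (simp only: split: if_split) blast
qed

text \<open>
  With a primitive third root of unity \<open>\<omega>\<close>, twice the rows \<open>(\<omega>\<^sup>2, \<omega>, 1)\<close> and \<open>(1, \<omega>, \<omega>\<^sup>2)\<close>.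
\<close>

lemma exists_type_3_3:
  fixes s :: "'a::field"
  assumes char_0: "CHAR('a) = 0" and phi: "is_phi \<phi>" and s: "s ^ 2 = - 3"
  shows "\<exists>A :: 'a^3^6. generic_arrangement A \<and> has_type \<phi> A {#3, 3#}"
proof (rule exists_type_of_frame[OF char_0 phi])
  note num = numeral_neq_0_CHAR[OF char_0]
  \<comment> \<open>The value on {1, 2, 6}. The products in \<open>E\<close> all equal 4 and those
    in \<open>F\<close> all equal 2s - 2, so E = 12 and F = 6s - 6.\<close>
  define x where "x = 6 * s - 18"
  have s2: "s * s = - 3"
    using s by (simp add: power2_eq_square)
  let ?S = "{1, 2, 6 :: 6}"
  have c: "frame_joubert (- s - 1) (s - 1) 2 2 (s - 1) (- s - 1) = (\<lambda>i. if i \<in> ?S then x else - x)" (is "?c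
      = _")
  proof -
    have "\<forall>i. ?c i = (if i \<in> ?S then x else - x)"
      unfolding forall_6 frame_joubert_def Let_def x_def by (simp add: algebra_simps s2)
    then show ?thesis by blast
  qed
  have x: "x \<noteq> 0"
  proof
    assume "x = 0"
    then have "6 * (s - 3) = 0"
      by (simp add: x_def algebra_simps)
    then have "s = 3"
      by (simp only: mult_eq_0_iff num simp_thms right_minus_eq)
    with s2 have "(9::'a) + 3 = 0" by simp
    then show False using num[of "num.Bit0 (num.Bit0 (num.Bit1 num.One))"] by simp
  qed
  \<comment> \<open>An opaque name for -x keeps the eight possible triple sums in the shape matched
    by \<open>sums\<close>.\<close>
  obtain y where y: "y = - x"
    by blast
  have sums: "x + x + x = 3 * x" "y + y + y = - (3 * x)" "x + x + y = x" "x + y + x = x" "y + x + x = x"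
    "x + y + y = - x" "y + x + y = - x" "y + y + x = - x"
    by (simp_all add: y algebra_simps)
  have neq: "x \<noteq> y" "y \<noteq> x"
  proof -
    have "x - y = 2 * x" by (simp add: y)
    moreover have "2 * x \<noteq> 0"
      by (simp only: mult_eq_0_iff num x simp_thms)
    ultimately show "x \<noteq> y" "y \<noteq> x" by auto
  qed
  note c = c[folded y]
  show "kernel_partition {{1, 2, 6}, {3, 4, 5}} ?c"
    unfolding kernel_partition_def UNIV_6 forall_6 c
    by (simp add: neq partition_on_insert partition_on_no_blocks_iff Diff_subset_conv disjnt_def)
  show "partition_type {{1, 2, 6}, {3, 4, 5}} = {#3, 3#}"
    by (simp add: partition_type_insert partition_type_eq_empty_iff[THEN iffD2] set_eq_iff forall_6
        numeral_eq_Suc)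
  have "3 * x \<noteq> 0"
    by (simp only: mult_eq_0_iff num x simp_thms)
  then show "?c i + ?c j + ?c k \<noteq> 0" if "i \<noteq> j" "j \<noteq> k" "i \<noteq> k" for i j k
    unfolding c by (cases "i \<in> ?S"; cases "j \<in> ?S"; cases "k \<in> ?S")
      (simp_all only: if_True if_False sums x neg_equal_0_iff_equal simp_thms)
qed

text \<open>A ring homomorphism from a field to the complex numbers is injective, so
  \<open>\<iota>\<close> presents an arbitrary subfield. Nonexistence is stated for a separate field
  \<open>'f\<close>, since it is not confined to subfields of the complex numbers.\<close>

theorem theorem15:
  fixes \<iota> :: "'k::field \<Rightarrow> complex"
    and \<phi> :: "(6 \<Rightarrow> 6) \<Rightarrow> (6 \<Rightarrow> 6)"
  assumes embedding: "\<iota> \<in> ring_hom ring_of_type_algebra ring_of_type_algebra"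
    and phi: "is_phi \<phi>"
  shows
    "(\<forall>\<nu> \<in> {{#1,1,1,1,1,1#}, {#1,1,1,1,2#}, {#1,1,1,3#}, {#1,1,2,2#}, {#1,1,4#}, {#1,2,3#}}.
        (\<exists>A :: 'k^3^6. generic_arrangement A \<and> has_type \<phi> A \<nu>) \<longleftrightarrow> \<rat> \<subseteq> range \<iota>) \<and>
     ((\<exists>A :: 'k^3^6. generic_arrangement A \<and> has_type \<phi> A {#1,5#})
        \<longleftrightarrow> complex_adjoin (csqrt 5) \<subseteq> range \<iota>) \<and>
     ((\<exists>A :: 'k^3^6. generic_arrangement A \<and> has_type \<phi> A {#3,3#})
        \<longleftrightarrow> complex_adjoin (csqrt (- 3)) \<subseteq> range \<iota>) \<and>
     (\<forall>\<nu> \<in> {{#2,2,2#}, {#2,4#}, {#6#}}.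
        \<not> (\<exists>A :: 'f::field_char_0^3^6. generic_arrangement A \<and> has_type \<phi> A \<nu>))"
proof -
  interpret embedding: field_embedding \<iota>
    by (rule field_embedding_of_ring_hom[OF embedding])
  note char_0 = embedding.CHAR_eq_0
  have rational: "\<forall>\<nu> \<in> {{#1,1,1,1,1,1#}, {#1,1,1,1,2#}, {#1,1,1,3#}, {#1,1,2,2#}, {#1,1,4#}, {#1,2,3#}}.
      (\<exists>A :: 'k^3^6. generic_arrangement A \<and> has_type \<phi> A \<nu>) \<longleftrightarrow> \<rat> \<subseteq> range \<iota>"
    using exists_rational_types[OF char_0 phi] embedding.Rats_subset_range by blast
  have sqrt_5: "(\<exists>A :: 'k^3^6. generic_arrangement A \<and> has_type \<phi> A {#1, 5#})
      \<longleftrightarrow> complex_adjoin (csqrt 5) \<subseteq> range \<iota>"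
    using embedding.complex_adjoin_csqrt_subset_range_iff[of 5]
      has_type_1_5_imp_sqrt_5[OF char_0 _ phi] exists_type_1_5[OF char_0 phi] by auto
  have sqrt_minus_3: "(\<exists>A :: 'k^3^6. generic_arrangement A \<and> has_type \<phi> A {#3, 3#})
      \<longleftrightarrow> complex_adjoin (csqrt (- 3)) \<subseteq> range \<iota>"
    using embedding.complex_adjoin_csqrt_subset_range_iff[of "- 3"]
      has_type_3_3_imp_sqrt_minus_3[OF char_0 _ phi] exists_type_3_3[OF char_0 phi] by auto
  have "CHAR('f) = 0"
    by simp
  then have none: "\<forall>\<nu> \<in> {{#2,2,2#}, {#2,4#}, {#6#}}.
      \<not> (\<exists>A :: 'f^3^6. generic_arrangement A \<and> has_type \<phi> A \<nu>)"
    using not_has_type_2_2_2[OF _ _ phi] not_has_type_2_4[OF _ _ phi] not_has_type_6[OF _ _ phi] by blast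
  show ?thesis
    by (intro conjI rational sqrt_5 sqrt_minus_3 none)
qed

end
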